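(* Let $N$ be a positive integer with prime factorization $N=\prod_{i=1}^n p_i^{k_i}$ (distinct primes $p_i$, $k_i\ge 1$), let $R=\mathbb{Z}_N[x^{\pm},y^{\pm}]$ and $f,g\in R$, and suppose the $\mathbf{BB}_N(f,g)$ code is topological. Then the additive group of the anyon module $\mathcal{C}$ of the $\mathbf{BB}_N(f,g)$ code is given by $$\mathcal{C}\cong\bigoplus_{i=1}^n\mathbb{Z}_{p_i^{k_i}}^{2Q_i},$$ where, for each $i$, $$Q_i=\dim_{\mathbb{Z}_{p_i}}\left(\frac{R_{p_i}}{(f,g)}\right)=\frac12\dim_{\mathbb{Z}_{p_i}}(\mathcal{C}_{p_i}),$$ and $\mathcal{C}_{p_i}$ is the anyon module of the $\mathbf{BB}_{p_i}(f,g)$ code.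
   Context: $\mathbb{Z}_N=\mathbb{Z}/N\mathbb{Z}$; $R=\mathbb{Z}_N[x^{\pm},y^{\pm}]$ is the Laurent polynomial ring in two variables. For $h\in R$, $\bar h(x,y)=h(x^{-1},y^{-1})$. The $\mathbf{BB}_N(f,g)$ code (the $\mathbb{Z}_N$ qudit bivariate-bicycle code specified by $f,g\in R$) is described by the chain complex of $R$-modules $R^2\xrightarrow{\partial}R^4\xrightarrow{\varepsilon}R^2$ with $$\partial=\begin{pmatrix}\bar f&0\\ \bar g&0\\ 0&g\\ 0&-f\end{pmatrix},\qquad \varepsilon=\begin{pmatrix}0&0&f&g\\ -\bar g&\bar f&0&0\end{pmatrix}.$$ The code is called topological if $\ker\varepsilon=\operatorname{im}\partial$; equivalently, if the complex $R\xrightarrow{(g,-f)^T}R^2\xrightarrow{(f\ g)}R$ is exact at $R^2$. The anyon module of the code is $\mathcal{C}=R^2/\operatorname{im}\varepsilon=\mathcal{Q}\oplus\overline{\mathcal{Q}}$, where $\mathcal{Q}=R/(f,g)$ and $\overline{\mathcal{Q}}=R/(\bar f,\bar g)$; its additive group structure encodes the fusion rules of anyons. For a prime $p\mid N$, $R_p=\mathbb{Z}_p[x^{\pm},y^{\pm}]\cong R/pR$, the $\mathbf{BB}_p(f,g)$ code is the code defined in the same way over $R_p$ by the reductions of $f,g$ modulo $p$, and in $R_p/(f,g)$ the ideal is the one generated by these reductions. *)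

theory Defs
  imports
    "HOL-Library.Product_Plus"
    "HOL-Number_Theory.Residues"
    "HOL-Algebra.Ideal"
    "HOL-Algebra.Product_Groups"
    "HOL-Algebra.Elementary_Groups"
    "Jordan_Normal_Form.Missing_VectorSpace"
begin

text \<open>
  The ring of integers modulo \<open>N\<close>. For \<open>N \<ge> 2\<close> this is \<^const>\<open>residue_ring\<close>; the
  library's ring has \<open>one = 1\<close> outside its carrier when \<open>N = 1\<close>, so the unit is taken modulo \<open>N\<close>.
\<close>

definition Zmod :: "nat \<Rightarrow> int ring" where
  "Zmod N = (residue_ring (int N)) \<lparr> one := 1 mod int N \<rparr>"

text \<open>
  Laurent polynomials in \<open>x, y\<close> over a commutative ring \<open>A\<close>: the value of \<open>h\<close> at \<open>(i, j)\<close>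
  is the coefficient of \<open>x\<^sup>i y\<^sup>j\<close>. The scalar multiplication is the one by elements of \<open>A\<close>.
\<close>

definition laurent2 :: "('a, 'm) ring_scheme \<Rightarrow> ('a, int \<times> int \<Rightarrow> 'a) module" where
  "laurent2 A =
    \<lparr> carrier = {h. range h \<subseteq> carrier A \<and> finite {e. h e \<noteq> \<zero>\<^bsub>A\<^esub>}},
      monoid.mult = (\<lambda>g h e. \<Oplus>\<^bsub>A\<^esub>d \<in> {d. g d \<noteq> \<zero>\<^bsub>A\<^esub>}. g d \<otimes>\<^bsub>A\<^esub> h (e - d)),
      one = (\<lambda>e. if e = (0, 0) then \<one>\<^bsub>A\<^esub> else \<zero>\<^bsub>A\<^esub>),
      zero = (\<lambda>e. \<zero>\<^bsub>A\<^esub>),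
      add = (\<lambda>g h e. g e \<oplus>\<^bsub>A\<^esub> h e),
      smult = (\<lambda>c h e. c \<otimes>\<^bsub>A\<^esub> h e) \<rparr>"

definition laurent_const :: "('a, 'm) ring_scheme \<Rightarrow> 'a \<Rightarrow> int \<times> int \<Rightarrow> 'a" where
  "laurent_const A c = (\<lambda>e. if e = (0, 0) then c else \<zero>\<^bsub>A\<^esub>)"

definition laurent_bar :: "(int \<times> int \<Rightarrow> 'a) \<Rightarrow> int \<times> int \<Rightarrow> 'a" where
  "laurent_bar h = (\<lambda>(i, j). h (- i, - j))"

definition laurent_reduce :: "nat \<Rightarrow> (int \<times> int \<Rightarrow> int) \<Rightarrow> int \<times> int \<Rightarrow> int" where
  "laurent_reduce p h = (\<lambda>e. h e mod int p)"

text \<open>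
  The quotient of a module by a submodule \<open>H\<close>. The ring multiplication and unit of a module
  record play no role.
\<close>

definition quot_module :: "('a, 'b, 'm) module_scheme \<Rightarrow> 'b set \<Rightarrow> ('a, 'b set) module" where
  "quot_module M H =
    \<lparr> carrier = a_rcosets\<^bsub>M\<^esub> H,
      monoid.mult = undefined,
      one = undefined,
      zero = H,
      add = (\<lambda>X Y. X <+>\<^bsub>M\<^esub> Y),
      smult = (\<lambda>r X. \<Union>v\<in>X. H +>\<^bsub>M\<^esub> (r \<odot>\<^bsub>M\<^esub> v)) \<rparr>"

definition restrict_scalars :: "('c \<Rightarrow> 'a) \<Rightarrow> ('a, 'b) module \<Rightarrow> ('c, 'b) module" where
  "restrict_scalars \<phi> M =
    \<lparr> carrier = carrier M, monoid.mult = monoid.mult M, one = one M, zero = zero M, add = add M,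
      smult = (\<lambda>c v. \<phi> c \<odot>\<^bsub>M\<^esub> v) \<rparr>"

text \<open>The free module \<open>R\<^sup>n\<close> of column vectors, as extensional functions on \<open>{..<n}\<close>.\<close>

abbreviation free_module :: "('a, 'm) ring_scheme \<Rightarrow> nat \<Rightarrow> ('a, nat \<Rightarrow> 'a) module" where
  "free_module R n \<equiv> ring.func_space R {..<n}"

text \<open>Matrices over \<open>R\<close> are given by the list of their rows.\<close>

definition mat_apply :: "('a, 'm) ring_scheme \<Rightarrow> 'a list list \<Rightarrow> (nat \<Rightarrow> 'a) \<Rightarrow> nat \<Rightarrow> 'a" where
  "mat_apply R M v =
    (\<lambda>i\<in>{..<length M}. \<Oplus>\<^bsub>R\<^esub>j\<in>{..<length (M ! i)}. M ! i ! j \<otimes>\<^bsub>R\<^esub> v j)"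

abbreviation bb_ring :: "nat \<Rightarrow> (int, int \<times> int \<Rightarrow> int) module" where
  "bb_ring N \<equiv> laurent2 (Zmod N)"

definition bb_boundary ::
  "nat \<Rightarrow> (int \<times> int \<Rightarrow> int) \<Rightarrow> (int \<times> int \<Rightarrow> int) \<Rightarrow>
    (nat \<Rightarrow> int \<times> int \<Rightarrow> int) \<Rightarrow> nat \<Rightarrow> int \<times> int \<Rightarrow> int" where
  "bb_boundary N f g = mat_apply (bb_ring N)
    [[laurent_bar f,         \<zero>\<^bsub>bb_ring N\<^esub>],
     [laurent_bar g,         \<zero>\<^bsub>bb_ring N\<^esub>],
     [\<zero>\<^bsub>bb_ring N\<^esub>,  g],
     [\<zero>\<^bsub>bb_ring N\<^esub>,  \<ominus>\<^bsub>bb_ring N\<^esub> f]]"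

definition bb_syndrome ::
  "nat \<Rightarrow> (int \<times> int \<Rightarrow> int) \<Rightarrow> (int \<times> int \<Rightarrow> int) \<Rightarrow>
    (nat \<Rightarrow> int \<times> int \<Rightarrow> int) \<Rightarrow> nat \<Rightarrow> int \<times> int \<Rightarrow> int" where
  "bb_syndrome N f g = mat_apply (bb_ring N)
    [[\<zero>\<^bsub>bb_ring N\<^esub>, \<zero>\<^bsub>bb_ring N\<^esub>, f, g],
     [\<ominus>\<^bsub>bb_ring N\<^esub> (laurent_bar g), laurent_bar f, \<zero>\<^bsub>bb_ring N\<^esub>, \<zero>\<^bsub>bb_ring N\<^esub>]]"

definition bb_topological ::
  "nat \<Rightarrow> (int \<times> int \<Rightarrow> int) \<Rightarrow> (int \<times> int \<Rightarrow> int) \<Rightarrow> bool" where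
  "bb_topological N f g \<longleftrightarrow>
    {v \<in> carrier (free_module (bb_ring N) 4).
        bb_syndrome N f g v = \<zero>\<^bsub>free_module (bb_ring N) 2\<^esub>}
      = bb_boundary N f g ` carrier (free_module (bb_ring N) 2)"

definition anyon_module ::
  "nat \<Rightarrow> (int \<times> int \<Rightarrow> int) \<Rightarrow> (int \<times> int \<Rightarrow> int) \<Rightarrow>
    (int \<times> int \<Rightarrow> int, (nat \<Rightarrow> int \<times> int \<Rightarrow> int) set) module" where
  "anyon_module N f g = quot_module (free_module (bb_ring N) 2)
    (bb_syndrome N f g ` carrier (free_module (bb_ring N) 4))"

text \<open>The modules \<open>\<C>\<close> and \<open>R/(f,g)\<close> with scalars in the integers modulo \<open>N\<close>.\<close>

definition anyon_space ::
  "nat \<Rightarrow> (int \<times> int \<Rightarrow> int) \<Rightarrow> (int \<times> int \<Rightarrow> int) \<Rightarrow>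
    (int, (nat \<Rightarrow> int \<times> int \<Rightarrow> int) set) module" where
  "anyon_space N f g = restrict_scalars (laurent_const (Zmod N)) (anyon_module N f g)"

definition ideal_quotient_space ::
  "nat \<Rightarrow> (int \<times> int \<Rightarrow> int) \<Rightarrow> (int \<times> int \<Rightarrow> int) \<Rightarrow>
    (int, (int \<times> int \<Rightarrow> int) set) module" where
  "ideal_quotient_space N f g = quot_module (bb_ring N) (Idl\<^bsub>bb_ring N\<^esub> {f, g})"

end

theory Submission
  imports Defs "HOL-Library.Poly_Mapping" "HOL-Library.Function_Algebras"
begin

text \<open>
  Lift \<open>f, g\<close> to Laurent polynomials \<open>F, G\<close> over the integers and work with congruences. The
  topological condition says that the Koszul complex of \<open>(F, G)\<close> is exact in the middle modulo \<open>N\<close>,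
  hence modulo each \<open>p ^ k\<close> exactly dividing \<open>N\<close>. Then \<open>F\<close> and \<open>G\<close> are not both zero modulo
  \<open>p\<close>, so one of them is a nonzerodivisor modulo every power of \<open>p\<close>, and exactness descends to all
  \<open>p ^ j\<close> with \<open>j \<le> k\<close>. This gives flatness: \<open>p ^ (k - 1) h \<in> (F, G, p ^ k)\<close> implies
  \<open>h \<in> (F, G, p)\<close>, so a basis modulo \<open>p\<close> lifts to a basis modulo \<open>p ^ k\<close>, and the primary parts
  are glued by the Chinese remainder theorem. Finiteness of \<open>R\<^sub>p/(f, g)\<close> comes from counting: by
  exactness the map \<open>(a, b) \<mapsto> F a + G b\<close> on polynomials supported in large boxes has a kernel of
  known size, and its image has bounded index in the box. The involution \<open>h \<mapsto> bar h\<close> transfers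
  everything to the second summand of the anyon module.
\<close>

section \<open>Laurent polynomials modulo an integer\<close>

text \<open>Integer Laurent polynomials are torsion free, so a common factor \<open>p ^ t\<close>
  can be cancelled in them, which is impossible modulo \<open>p ^ k\<close>; moreover one pair of
  lifts serves the moduli \<open>N\<close>, \<open>p ^ k\<close> and \<open>p\<close> at once. The
  main obstacle is finiteness. Exactness in the middle is only a statement about syzygies: modulo
  \<open>p\<close> it says that \<open>f\<close> and \<open>g\<close> have no common factor. That
  two coprime Laurent polynomials in two variables have a finite-dimensional quotient is usually
  dimension theory. Here it comes from comparing areas of boxes of size about \<open>n\<close>:
  since all syzygies are multiples of \<open>(G, - F)\<close>, the terms of order \<open>n\<close>
  and higher cancel, and what survives is the mixed area of the bounding boxes of \<open>F\<close>
  and \<open>G\<close>, as in Bernstein's bound for common zeros on the torus. The bound need not be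
  sharp: it only guarantees that a maximal independent family modulo \<open>p\<close> exists, and
  the length of that family is then identified with \<open>Q i\<close>, which may be 0.\<close>

type_synonym laurent = "(int \<times> int) \<Rightarrow>\<^sub>0 int"

abbreviation coef :: "laurent \<Rightarrow> int \<times> int \<Rightarrow> int" where
  "coef \<equiv> Poly_Mapping.lookup"

text \<open>Summing over the exponents of one factor only is the shape of the product in
  \<open>laurent2\<close>, so the two can be compared term by term.\<close>

lemma coef_mult: "coef (a * b) e = (\<Sum>d\<in>Poly_Mapping.keys a. coef a d * coef b (e - d))"
proof -
  have inner: "(\<Sum>q. coef b q when e = d + q) = coef b (e - d)" for d
  proof -
    have eq: "(e = d + q) = (q = e - d)" for q
      by (auto simp: algebra_simps)
    show ?thesis
      unfolding eq by simp
  qed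
  show ?thesis
    unfolding Poly_Mapping.lookup_mult inner
    by (rule Sum_any.expand_superset) (auto simp: in_keys_iff)
qed

lemma coef_of_nat_mult: "coef (of_nat n * a) e = int n * coef a e"
  by (induction n) (simp_all add: algebra_simps Poly_Mapping.lookup_add)

lemma coef_of_int_mult [simp]: "coef (of_int c * a) e = c * coef a e"
proof -
  obtain m n where c: "c = int m - int n"
    by (rule int_diff_cases)
  show ?thesis
    by (simp add: c left_diff_distrib coef_of_nat_mult Poly_Mapping.lookup_minus)
qed

lemma of_int_mult_cancel:
  assumes "c \<noteq> 0" "of_int c * a = of_int c * (b :: laurent)"
  shows "a = b"
proof (rule poly_mapping_eqI)
  fix e
  have "c * coef a e = c * coef b e"
    using arg_cong [OF assms(2), of "\<lambda>h. coef h e"] by simp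
  then show "coef a e = coef b e"
    using assms(1) by simp
qed

lemma of_int_dvd_iff: "of_int m dvd a \<longleftrightarrow> (\<forall>e. m dvd coef a e)"
proof
  assume "of_int m dvd a"
  then show "\<forall>e. m dvd coef a e"
    by (auto elim!: dvdE)
next
  assume *: "\<forall>e. m dvd coef a e"
  have "a = of_int m * Poly_Mapping.map (\<lambda>x. x div m) a"
    by (rule poly_mapping_eqI) (use * in \<open>auto simp: Poly_Mapping.map.rep_eq when_def\<close>)
  then show "of_int m dvd a"
    by (rule dvdI)
qed

lemma of_int_mult_dvd_cancel:
  "c \<noteq> 0 \<Longrightarrow> of_int (c * m) dvd of_int c * (a :: laurent) \<longleftrightarrow> of_int m dvd a"
  by (simp add: of_int_dvd_iff del: of_int_mult)

section \<open>Supports modulo a prime, and divisibility of products\<close>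

definition supp :: "int \<Rightarrow> laurent \<Rightarrow> (int \<times> int) set" where
  "supp p a = {e. \<not> p dvd coef a e}"

lemma finite_supp [simp]: "finite (supp p a)"
  by (rule finite_subset [of _ "Poly_Mapping.keys a"]) (auto simp: supp_def in_keys_iff)

lemma supp_eq_empty_iff: "supp p a = {} \<longleftrightarrow> of_int p dvd a"
  by (auto simp: supp_def of_int_dvd_iff)

text \<open>Maximality is for the lexicographic order given by \<open>l\<close> and then
  \<open>m\<close>. Ties remain only where both agree, and joint injectivity of \<open>l\<close> and
  \<open>m\<close> rules these out where the lemma is applied.\<close>

lemma lex_maximum:
  fixes l m :: "'a \<Rightarrow> int"
  assumes "finite S" "S \<noteq> {}"
  shows "\<exists>s\<in>S. \<forall>t\<in>S. l t < l s \<or> l t = l s \<and> m t \<le> m s"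
  using assms
proof (induction rule: finite_ne_induct)
  case (insert x S)
  then obtain s where s: "s \<in> S" "\<forall>t\<in>S. l t < l s \<or> l t = l s \<and> m t \<le> m s"
    by blast
  show ?case
  proof (cases "l x < l s \<or> l x = l s \<and> m x \<le> m s")
    case True
    with s show ?thesis by blast
  next
    case False
    then have "\<forall>t\<in>insert x S. l t < l x \<or> l t = l x \<and> m t \<le> m x"
      using s by force
    then show ?thesis by blast
  qed
qed simp

text \<open>The lexicographically leading monomials of the factors multiply without cancellation.\<close>

lemma supp_mult_extent:
  fixes l m :: "int \<times> int \<Rightarrow> int"
  assumes p: "prime p"
    and l: "\<And>x y. l (x + y) = l x + l y" and m: "\<And>x y. m (x + y) = m x + m y"
    and inj: "\<And>x y. l x = l y \<Longrightarrow> m x = m y \<Longrightarrow> x = y"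
    and s: "s \<in> supp p a" and t: "t \<in> supp p b"
  shows "\<exists>z\<in>supp p (a * b). l s + l t \<le> l z"
proof -
  obtain s' where s': "s' \<in> supp p a"
      "\<forall>u\<in>supp p a. l u < l s' \<or> l u = l s' \<and> m u \<le> m s'"
    using lex_maximum [of "supp p a" l m] s by (metis empty_iff finite_supp)
  obtain t' where t': "t' \<in> supp p b"
      "\<forall>u\<in>supp p b. l u < l t' \<or> l u = l t' \<and> m u \<le> m t'"
    using lex_maximum [of "supp p b" l m] t by (metis empty_iff finite_supp)
  \<comment> \<open>By additivity, a second contributing pair \<open>d\<close>,
    \<open>s' + t' - d\<close> has the same total in \<open>l\<close> and in \<open>m\<close> as the
    two maxima. Neither member can exceed its maximum, so both attain it, and \<open>d = s'\<close>
    follows.\<close>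
  have other: "p dvd coef a d * coef b (s' + t' - d)" if "d \<noteq> s'" for d
  proof (rule ccontr)
    assume "\<not> ?thesis"
    then have d: "d \<in> supp p a" "s' + t' - d \<in> supp p b"
      by (auto simp: supp_def)
    have "l d + l (s' + t' - d) = l s' + l t'" "m d + m (s' + t' - d) = m s' + m t'"
      by (simp_all flip: l m)
    with d s'(2) t'(2) have "l d = l s'" "m d = m s'"
      by force+
    with inj that show False
      by blast
  qed
  have "s' \<in> Poly_Mapping.keys a"
    using s' by (auto simp: supp_def in_keys_iff)
  then have "coef (a * b) (s' + t') =
      coef a s' * coef b t' + (\<Sum>d\<in>Poly_Mapping.keys a - {s'}. coef a d * coef b (s' + t' - d))"
    unfolding coef_mult by (subst sum.remove [of _ s']) auto
  moreover have "p dvd (\<Sum>d\<in>Poly_Mapping.keys a - {s'}. coef a d * coef b (s' + t' - d))"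
    by (rule dvd_sum) (use other in auto)
  moreover have "\<not> p dvd coef a s' * coef b t'"
    using s' t' p by (auto simp: supp_def prime_dvd_mult_iff)
  ultimately have "s' + t' \<in> supp p (a * b)"
    by (simp add: supp_def dvd_add_left_iff)
  moreover have "l s + l t \<le> l (s' + t')"
    using s'(2) t'(2) s t by (fastforce simp: l)
  ultimately show ?thesis
    by blast
qed

text \<open>Laurent polynomials over a field form a domain: factors with nonempty supports modulo
  \<open>p\<close> have a product with nonempty support.\<close>

lemma prime_dvd_mult_laurent:
  assumes "prime p" "of_int p dvd a * (b :: laurent)"
  shows "of_int p dvd a \<or> of_int p dvd b"
  using supp_mult_extent [OF assms(1), of fst snd _ a _ b] assms(2)
  unfolding supp_eq_empty_iff [symmetric] by (fastforce simp: prod_eq_iff)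

text \<open>A nonzerodivisor modulo \<open>p\<close> stays one modulo \<open>p ^ t\<close>: if
  \<open>p ^ t\<close> has already been extracted from \<open>b\<close>, cancelling it leaves a
  product divisible by \<open>p\<close>, and the domain property extracts one more factor.\<close>

lemma prime_power_dvd_mult_laurent:
  assumes "prime p" "\<not> of_int p dvd a" "of_int (p ^ t) dvd a * (b :: laurent)"
  shows "of_int (p ^ t) dvd b"
  using assms(3)
proof (induction t)
  case (Suc t)
  have "(of_int (p ^ t) :: laurent) dvd of_int (p ^ Suc t)"
    by simp
  with Suc obtain c where c: "b = of_int (p ^ t) * c"
    by (blast intro: dvd_trans elim: dvdE)
  have "p ^ t \<noteq> 0"
    using assms(1) by auto
  have "of_int (p ^ t * p) dvd of_int (p ^ t) * (a * c)"
    using Suc.prems by (simp add: c ac_simps)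
  then have "of_int p dvd a * c"
    using \<open>p ^ t \<noteq> 0\<close> of_int_mult_dvd_cancel by blast
  then have "of_int p dvd c"
    using prime_dvd_mult_laurent assms by blast
  then have "of_int (p ^ t * p) dvd of_int (p ^ t) * c"
    using \<open>p ^ t \<noteq> 0\<close> of_int_mult_dvd_cancel by blast
  then show ?case
    by (simp add: c ac_simps)
qed simp

text \<open>Exactness of \<open>R \<rightarrow> R\<^sup>2 \<rightarrow> R\<close> at \<open>R\<^sup>2\<close>, expressed for integer lifts of \<open>f, g\<close>.\<close>

definition koszul_exact :: "int \<Rightarrow> laurent \<Rightarrow> laurent \<Rightarrow> bool" where
  "koszul_exact m F G \<longleftrightarrow> (\<forall>a b. of_int m dvd F * a + G * b \<longrightarrow>
    (\<exists>r. of_int m dvd a - G * r \<and> of_int m dvd b + F * r))"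

section \<open>Exactness passed on from \<open>N\<close> to \<open>p ^ k\<close> and to lower
  powers\<close>

lemma koszul_exactE:
  assumes "koszul_exact m F G" "of_int m dvd F * a + G * b"
  obtains r where "of_int m dvd a - G * r" "of_int m dvd b + F * r"
  using assms unfolding koszul_exact_def by blast

text \<open>The generating syzygy \<open>(G, - F)\<close> changes sign when \<open>F\<close> and
  \<open>G\<close> are exchanged, hence the witness \<open>- r\<close>. The counting argument may
  thus assume that \<open>F\<close> is the one not divisible by \<open>p\<close>.\<close>

lemma koszul_exact_sym: "koszul_exact m F G \<Longrightarrow> koszul_exact m G F"
  unfolding koszul_exact_def
proof (intro allI impI)
  fix a b
  assume *: "\<forall>a b. of_int m dvd F * a + G * b \<longrightarrow>
    (\<exists>r. of_int m dvd a - G * r \<and> of_int m dvd b + F * r)"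
    and "of_int m dvd G * a + F * b"
  then obtain r where "of_int m dvd b - G * r \<and> of_int m dvd a + F * r"
    by (metis add.commute)
  then show "\<exists>r. of_int m dvd a - F * r \<and> of_int m dvd b + G * r"
    by (intro exI [of _ "- r"]) simp
qed

text \<open>Multiplying a syzygy modulo \<open>m\<close> by \<open>q\<close> makes it one modulo
  \<open>m * q\<close>, where exactness supplies \<open>r\<close>. The factor \<open>q\<close> is
  then undone by its inverse \<open>v\<close> modulo \<open>m\<close>, so
  \<open>of_int v * r\<close> is the witness.\<close>

lemma koszul_exact_coprime_factor:
  assumes ex: "koszul_exact (m * q) F G" and cop: "coprime m q"
  shows "koszul_exact m F G"
  unfolding koszul_exact_def
proof (intro allI impI)
  fix a b
  assume "of_int m dvd F * a + G * b"
  then have "of_int m * of_int q dvd (F * a + G * b) * of_int q"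
    by (rule mult_dvd_mono) simp
  then have "of_int (m * q) dvd F * (of_int q * a) + G * (of_int q * b)"
    by (simp add: algebra_simps)
  then obtain r where r: "of_int (m * q) dvd of_int q * a - G * r"
      "of_int (m * q) dvd of_int q * b + F * r"
    using ex by (blast elim: koszul_exactE)
  have dv: "(of_int m :: laurent) dvd of_int (m * q)"
    by simp
  obtain u v where "u * m + v * q = 1"
    using bezout_int [of m q] cop by auto
  then have "of_int (u * m + v * q) = (1 :: laurent)"
    by simp
  then have uv: "of_int u * of_int m + of_int v * of_int q = (1 :: laurent)"
    by simp
  have "a - G * (of_int v * r) = (of_int u * of_int m + of_int v * of_int q) * a - G * (of_int v * r)"
    by (simp add: uv)
  also have "\<dots> = of_int m * (of_int u * a) + of_int v * (of_int q * a - G * r)"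
    by (simp add: algebra_simps)
  finally have A: "of_int m dvd a - G * (of_int v * r)"
    using dvd_trans [OF dv r(1)] by simp
  have "b + F * (of_int v * r) = (of_int u * of_int m + of_int v * of_int q) * b + F * (of_int v * r)"
    by (simp add: uv)
  also have "\<dots> = of_int m * (of_int u * b) + of_int v * (of_int q * b + F * r)"
    by (simp add: algebra_simps)
  finally have "of_int m dvd b + F * (of_int v * r)"
    using dvd_trans [OF dv r(2)] by simp
  with A show "\<exists>r. of_int m dvd a - G * r \<and> of_int m dvd b + F * r"
    by blast
qed

text \<open>
  If \<open>p\<close> divided \<open>F = p F'\<close> and \<open>G = p G'\<close>, exactness at \<open>(G', - F')\<close> would give
  \<open>F' \<equiv> F s\<close> and \<open>G' \<equiv> G s\<close>, so that every power of \<open>p\<close> up to \<open>p ^ k\<close> divides both.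
\<close>

lemma koszul_exact_not_both_zero:
  assumes p: "prime p" and "k \<ge> 1" and ex: "koszul_exact (p ^ k) F G"
  shows "\<not> (of_int p dvd F \<and> of_int p dvd G)"
proof
  assume "of_int p dvd F \<and> of_int p dvd G"
  then obtain F' G' where F': "F = of_int p * F'" and G': "G = of_int p * G'"
    by (auto elim!: dvdE)
  have "F * G' + G * (- F') = 0"
    by (simp add: F' G')
  then obtain s where s: "of_int (p ^ k) dvd G' - G * s" "of_int (p ^ k) dvd - F' + F * s"
    using ex by (metis koszul_exactE dvd_0_right)
  have pow: "(of_int (p ^ t) :: laurent) dvd of_int (p ^ k)" if "t \<le> k" for t
    using le_imp_power_dvd [OF that, of "of_int p :: laurent"] by simp
  have "of_int (p ^ t) dvd F \<and> of_int (p ^ t) dvd G" if "t \<le> k" for t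
    using that
  proof (induction t)
    case (Suc t)
    then have IH: "of_int (p ^ t) dvd F" "of_int (p ^ t) dvd G" "t \<le> k"
      by auto
    \<comment> \<open>The difference is \<open>F'\<close>, so divisibility of
      \<open>F = p F'\<close> gains one power of \<open>p\<close>.\<close>
    have "of_int (p ^ t) dvd F * s - (- F' + F * s)"
      using IH s(2) pow [of t] by (blast intro: dvd_diff dvd_mult2 dvd_trans)
    then have "of_int p * of_int (p ^ t) dvd of_int p * F'"
      by (intro mult_dvd_mono) simp_all
    moreover have "of_int (p ^ t) dvd (G' - G * s) + G * s"
      using IH s(1) pow [of t] by (blast intro: dvd_add dvd_mult2 dvd_trans)
    then have "of_int p * of_int (p ^ t) dvd of_int p * G'"
      by (intro mult_dvd_mono) simp_all
    ultimately show ?case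
      by (simp add: F' G')
  qed simp
  then have FG: "of_int (p ^ k) dvd F" "of_int (p ^ k) dvd G"
    by auto
  \<comment> \<open>With \<open>F\<close> zero modulo \<open>p ^ k\<close>, the pair
    \<open>(1, 0)\<close> is a syzygy; exactness makes 1 a multiple of \<open>G\<close>, which is
    zero as well.\<close>
  then have "of_int (p ^ k) dvd F * 1 + G * 0"
    by simp
  then obtain r where "of_int (p ^ k) dvd 1 - G * r"
    using ex by (blast elim: koszul_exactE)
  then have "of_int (p ^ k) dvd (1 - G * r) + G * r"
    using FG by (blast intro: dvd_add dvd_mult2)
  then have "of_int (p ^ k) dvd (1 :: laurent)"
    by simp
  then have "p ^ k dvd coef 1 0"
    unfolding of_int_dvd_iff by blast
  then have "p ^ k dvd 1"
    by (simp add: lookup_one)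
  then show False
    using p \<open>k \<ge> 1\<close> is_unit_power_iff not_prime_unit by (metis not_one_le_zero)
qed

text \<open>Scaling a syzygy modulo \<open>p ^ j\<close> by \<open>?q = p ^ (k - j)\<close> gives
  one modulo \<open>p ^ k\<close>, whose witness \<open>r\<close> satisfies \<open>G r\<close> =
  \<open>F r\<close> = 0 modulo \<open>?q\<close>. As one of \<open>F\<close>, \<open>G\<close> is a
  nonzerodivisor modulo \<open>?q\<close>, the witness is itself divisible by \<open>?q\<close>, and
  the quotient is the witness modulo \<open>p ^ j\<close>.\<close>

lemma koszul_exact_prime_power_le:
  assumes p: "prime p" and "k \<ge> 1" and ex: "koszul_exact (p ^ k) F G" and "j \<le> k"
  shows "koszul_exact (p ^ j) F G"
  unfolding koszul_exact_def
proof (intro allI impI)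
  fix a b
  assume ab: "of_int (p ^ j) dvd F * a + G * b"
  let ?q = "p ^ (k - j)"
  have q0: "?q \<noteq> 0"
    using p by auto
  have qj: "?q * p ^ j = p ^ k"
    using \<open>j \<le> k\<close> by (simp flip: power_add)
  have "of_int (?q * p ^ j) dvd of_int ?q * (F * a + G * b)"
    using ab q0 of_int_mult_dvd_cancel by blast
  then have "of_int (p ^ k) dvd F * (of_int ?q * a) + G * (of_int ?q * b)"
    unfolding qj by (simp add: algebra_simps)
  then obtain r where r: "of_int (p ^ k) dvd of_int ?q * a - G * r"
      "of_int (p ^ k) dvd of_int ?q * b + F * r"
    using ex by (blast elim: koszul_exactE)
  have dv: "(of_int ?q :: laurent) dvd of_int (p ^ k)"
    unfolding qj [symmetric] by simp
  have "of_int ?q dvd of_int ?q * a - (of_int ?q * a - G * r)"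
    using dvd_trans [OF dv r(1)] by (rule dvd_diff [OF dvd_triv_left])
  moreover have "of_int ?q dvd (of_int ?q * b + F * r) - of_int ?q * b"
    using dvd_trans [OF dv r(2)] by (rule dvd_diff) simp
  ultimately have "of_int ?q dvd G * r" "of_int ?q dvd F * r"
    by simp_all
  then have "of_int ?q dvd r"
    using koszul_exact_not_both_zero [OF p \<open>k \<ge> 1\<close> ex] prime_power_dvd_mult_laurent [OF p]
    by blast
  then obtain r' where r': "r = of_int ?q * r'"
    by (rule dvdE)
  have "of_int (?q * p ^ j) dvd of_int ?q * (a - G * r')"
    "of_int (?q * p ^ j) dvd of_int ?q * (b + F * r')"
    unfolding qj using r by (simp_all add: r' algebra_simps)
  then show "\<exists>r. of_int (p ^ j) dvd a - G * r \<and> of_int (p ^ j) dvd b + F * r"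
    using q0 of_int_mult_dvd_cancel by blast
qed

section \<open>The preimage in the integer Laurent ring of the ideal (f, g) modulo \<open>m\<close>,
  and flatness\<close>

definition mod_ideal :: "int \<Rightarrow> laurent \<Rightarrow> laurent \<Rightarrow> laurent set" where
  "mod_ideal m F G = {F * a + G * b + of_int m * c | a b c. True}"

lemma mod_idealI: "x = F * a + G * b + of_int m * c \<Longrightarrow> x \<in> mod_ideal m F G"
  by (auto simp: mod_ideal_def)

text \<open>In \<open>of_int ?q * h = F a + G b + of_int (p ^ k) * c\<close> the pair
  \<open>(a, b)\<close> is a syzygy modulo \<open>?q\<close>. Subtracting a multiple of
  \<open>(G, - F)\<close> leaves \<open>F a + G b\<close> unchanged and makes both entries divisible
  by \<open>?q\<close>, which then cancels. In other words, multiplication by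
  \<open>p ^ (k - 1)\<close> embeds the quotient modulo \<open>p\<close> into the quotient modulo
  \<open>p ^ k\<close>.\<close>

lemma mod_ideal_flat:
  assumes p: "prime p" and k: "k \<ge> 1" and ex: "koszul_exact (p ^ k) F G"
    and h: "of_int (p ^ (k - 1)) * h \<in> mod_ideal (p ^ k) F G"
  shows "h \<in> mod_ideal p F G"
proof -
  let ?q = "p ^ (k - 1)"
  have q0: "?q \<noteq> 0"
    using p by auto
  have qp: "p ^ k = ?q * p"
    using k by (cases k) auto
  obtain a b c where abc: "of_int ?q * h = F * a + G * b + of_int (p ^ k) * c"
    using h by (auto simp: mod_ideal_def)
  have "F * a + G * b = of_int ?q * (h - of_int p * c)"
    using abc unfolding qp by (simp add: algebra_simps)
  then have "of_int ?q dvd F * a + G * b"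
    by simp
  then obtain r where "of_int ?q dvd a - G * r" "of_int ?q dvd b + F * r"
    using koszul_exact_prime_power_le [OF p k ex, of "k - 1"] by (auto elim: koszul_exactE)
  then obtain a' b' where "a - G * r = of_int ?q * a'" "b + F * r = of_int ?q * b'"
    by (auto elim!: dvdE)
  then have ab: "a = G * r + of_int ?q * a'" "b = of_int ?q * b' - F * r"
    by (simp_all add: algebra_simps)
  have "of_int ?q * h = of_int ?q * (F * a' + G * b' + of_int p * c)"
    unfolding abc ab qp by (simp add: algebra_simps)
  then have "h = F * a' + G * b' + of_int p * c"
    using q0 of_int_mult_cancel by blast
  then show ?thesis
    by (auto simp: mod_ideal_def)
qed

section \<open>Ideals\<close>

text \<open>Stated for a whole type, so that Laurent polynomials and pairs of them, which are
  functions into Laurent polynomials, fall under the same lemmas.\<close>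

definition ring_ideal :: "'a :: comm_ring_1 set \<Rightarrow> bool" where
  "ring_ideal I \<longleftrightarrow> 0 \<in> I \<and> (\<forall>a\<in>I. \<forall>b\<in>I. a + b \<in> I) \<and> (\<forall>r. \<forall>a\<in>I. r * a \<in> I)"

lemma ring_ideal_zero: "ring_ideal I \<Longrightarrow> 0 \<in> I"
  and ring_ideal_add: "ring_ideal I \<Longrightarrow> a \<in> I \<Longrightarrow> b \<in> I \<Longrightarrow> a + b \<in> I"
  and ring_ideal_mult: "ring_ideal I \<Longrightarrow> a \<in> I \<Longrightarrow> r * a \<in> I"
  by (auto simp: ring_ideal_def)

lemma ring_ideal_uminus: "ring_ideal I \<Longrightarrow> a \<in> I \<Longrightarrow> - a \<in> I"
  using ring_ideal_mult [of I a "- 1"] by simp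

lemma ring_ideal_diff: "ring_ideal I \<Longrightarrow> a \<in> I \<Longrightarrow> b \<in> I \<Longrightarrow> a - b \<in> I"
  using ring_ideal_add [of I a "- b"] ring_ideal_uminus [of I b] by simp

lemma ring_ideal_diff_trans: "ring_ideal I \<Longrightarrow> a - b \<in> I \<Longrightarrow> b - c \<in> I \<Longrightarrow> a - c \<in> I"
  using ring_ideal_add [of I "a - b" "b - c"] by simp

lemma ring_ideal_sum: "ring_ideal I \<Longrightarrow> (\<And>x. x \<in> X \<Longrightarrow> h x \<in> I) \<Longrightarrow> sum h X \<in> I"
  by (induction X rule: infinite_finite_induct) (auto intro: ring_ideal_add ring_ideal_zero)

lemma ring_ideal_dvd: "ring_ideal I \<Longrightarrow> a \<in> I \<Longrightarrow> a dvd b \<Longrightarrow> b \<in> I"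
  by (metis dvdE mult.commute ring_ideal_mult)

lemma of_int_dvd_of_int: "a dvd b \<Longrightarrow> (of_int a :: 'a :: comm_ring_1) dvd of_int b"
  by (auto elim!: dvdE)

lemma ring_ideal_mod_ideal: "ring_ideal (mod_ideal m F G)"
proof -
  have "0 \<in> mod_ideal m F G"
    unfolding mod_ideal_def by (rule CollectI, rule exI [of _ 0], rule exI [of _ 0], rule exI [of _ 0]) simp
  moreover have "x + y \<in> mod_ideal m F G" if "x \<in> mod_ideal m F G" "y \<in> mod_ideal m F G" for x y
  proof -
    obtain a b c a' b' c' where "x = F * a + G * b + of_int m * c" "y = F * a' + G * b' + of_int m * c'"
      using \<open>x \<in> mod_ideal m F G\<close> \<open>y \<in> mod_ideal m F G\<close> unfolding mod_ideal_def by blast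
    then have "x + y = F * (a + a') + G * (b + b') + of_int m * (c + c')"
      by (simp add: algebra_simps)
    then show ?thesis
      unfolding mod_ideal_def by blast
  qed
  moreover have "r * x \<in> mod_ideal m F G" if "x \<in> mod_ideal m F G" for r x
  proof -
    obtain a b c where "x = F * a + G * b + of_int m * c"
      using \<open>x \<in> mod_ideal m F G\<close> by (auto simp: mod_ideal_def)
    then have "r * x = F * (r * a) + G * (r * b) + of_int m * (r * c)"
      by (simp add: algebra_simps)
    then show ?thesis
      unfolding mod_ideal_def by blast
  qed
  ultimately show ?thesis
    by (auto simp: ring_ideal_def)
qed

lemma mod_ideal_generators:
  "F \<in> mod_ideal m F G" "G \<in> mod_ideal m F G" "of_int m \<in> mod_ideal m F G"
proof -
  have "F = F * 1 + G * 0 + of_int m * 0" "G = F * 0 + G * 1 + of_int m * 0"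
    "(of_int m :: laurent) = F * 0 + G * 0 + of_int m * 1"
    by simp_all
  then show "F \<in> mod_ideal m F G" "G \<in> mod_ideal m F G" "of_int m \<in> mod_ideal m F G"
    unfolding mod_ideal_def by blast+
qed

section \<open>Finiteness of the quotient modulo a prime\<close>

definition reduce :: "int \<Rightarrow> laurent \<Rightarrow> laurent" where
  "reduce p a = Poly_Mapping.map (\<lambda>x. x mod p) a"

lemma coef_reduce [simp]: "coef (reduce p a) e = coef a e mod p"
  by (simp add: reduce_def Poly_Mapping.map.rep_eq when_def)

lemma dvd_diff_reduce: "of_int p dvd a - reduce p a"
  by (simp add: of_int_dvd_iff Poly_Mapping.lookup_minus)

text \<open>Canonical representatives of the space of polynomials modulo \<open>p\<close> supported
  in \<open>S\<close>. Cardinalities \<open>p ^ card S\<close> take the place of dimensions in the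
  counting.\<close>

definition reduced :: "int \<Rightarrow> (int \<times> int) set \<Rightarrow> laurent set" where
  "reduced p S = {a. (\<forall>e. coef a e \<in> {0..<p}) \<and> (\<forall>e. e \<notin> S \<longrightarrow> coef a e = 0)}"

lemma reduce_in_reduced: "p > 0 \<Longrightarrow> supp p a \<subseteq> S \<Longrightarrow> reduce p a \<in> reduced p S"
  by (simp add: reduced_def supp_def subset_iff del: split_paired_All) (metis dvd_eq_mod_eq_0)

lemma reduced_eqI:
  assumes "a \<in> reduced p S" "b \<in> reduced p S" "of_int p dvd a - b"
  shows "a = b"
proof (rule poly_mapping_eqI)
  fix e
  have "coef a e mod p = coef b e mod p"
    using assms(3) unfolding of_int_dvd_iff Poly_Mapping.lookup_minus mod_eq_dvd_iff by blast
  then show "coef a e = coef b e"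
    using assms(1,2) by (simp add: reduced_def del: split_paired_All)
qed

lemma supp_reduced: "a \<in> reduced p S \<Longrightarrow> supp p a \<subseteq> S"
  unfolding reduced_def supp_def by fastforce

lemma bij_betw_reduced:
  assumes "finite S" "p > 0"
  shows "bij_betw (\<lambda>a. restrict (coef a) S) (reduced p S) (S \<rightarrow>\<^sub>E {0..<p})"
proof (rule bij_betwI')
  fix a b
  assume ab: "a \<in> reduced p S" "b \<in> reduced p S"
  show "restrict (coef a) S = restrict (coef b) S \<longleftrightarrow> a = b"
  proof
    assume *: "restrict (coef a) S = restrict (coef b) S"
    show "a = b"
    proof (rule poly_mapping_eqI)
      show "coef a e = coef b e" for e
        using ab fun_cong [OF *, of e] by (cases "e \<in> S") (simp_all add: reduced_def del: split_paired_All)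
    qed
  qed simp
next
  show "restrict (coef a) S \<in> S \<rightarrow>\<^sub>E {0..<p}" if "a \<in> reduced p S" for a
    using that by (auto simp: reduced_def)
next
  fix h
  assume h: "h \<in> S \<rightarrow>\<^sub>E {0..<p}"
  define a where "a = Abs_poly_mapping (\<lambda>e. if e \<in> S then h e else 0)"
  have "finite {e. (if e \<in> S then h e else 0) \<noteq> 0}"
    by (rule finite_subset [OF _ \<open>finite S\<close>]) auto
  then have a: "coef a e = (if e \<in> S then h e else 0)" for e
    by (simp add: a_def)
  have "a \<in> reduced p S"
    using h \<open>p > 0\<close> by (auto simp: reduced_def a PiE_iff)
  moreover have "h = restrict (coef a) S"
    using h by (auto simp: a PiE_iff extensional_def restrict_def)
  ultimately show "\<exists>a\<in>reduced p S. h = restrict (coef a) S"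
    by blast
qed

lemma card_reduced:
  assumes "finite S" "p > 0"
  shows "card (reduced p S) = nat p ^ card S"
  using bij_betw_same_card [OF bij_betw_reduced [OF assms]] assms(1)
  by (simp add: card_PiE)

lemma finite_reduced:
  assumes "finite S" "p > 0"
  shows "finite (reduced p S)"
  using bij_betw_finite [OF bij_betw_reduced [OF assms]] assms(1)
  by (simp add: finite_PiE)

lemma supp_add: "supp p (a + b) \<subseteq> supp p a \<union> supp p b"
  by (auto simp: supp_def Poly_Mapping.lookup_add)

lemma supp_mult:
  assumes "e \<in> supp p (a * b)"
  obtains d where "d \<in> supp p a" "e - d \<in> supp p b"
proof -
  have "\<not> (\<forall>d\<in>Poly_Mapping.keys a. p dvd coef a d * coef b (e - d))"
    using assms by (auto simp: supp_def coef_mult intro: dvd_sum)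
  then obtain d where "\<not> p dvd coef a d * coef b (e - d)"
    by blast
  then show thesis
    using that [of d] unfolding supp_def mem_Collect_eq by (meson dvd_mult dvd_mult2)
qed

text \<open>
  Modulo the kernel of \<open>(t, a, b) \<mapsto> t + F a + G b\<close>, which exactness identifies with the
  multiples \<open>r (G, - F)\<close>, this is an injection.
\<close>

lemma incongruent_count:
  assumes p: "prime p" and ex: "koszul_exact p F G"
    and fin: "finite S" "finite S1" "finite S2" "finite S3" "finite T"
    and T: "\<And>t u. t \<in> T \<Longrightarrow> u \<in> T \<Longrightarrow> t - u \<in> mod_ideal p F G \<Longrightarrow> t = u"
    and TS: "\<And>t. t \<in> T \<Longrightarrow> supp p t \<subseteq> S"
    and S1: "\<And>a. supp p a \<subseteq> S1 \<Longrightarrow> supp p (F * a) \<subseteq> S"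
    and S2: "\<And>b. supp p b \<subseteq> S2 \<Longrightarrow> supp p (G * b) \<subseteq> S"
    and S3: "\<And>r. supp p (F * r) \<subseteq> S2 \<Longrightarrow> supp p r \<subseteq> S3"
  shows "card T * nat p ^ (card S1 + card S2) \<le> nat p ^ (card S + card S3)"
proof -
  have p0: "p > 0"
    using p prime_gt_0_int by blast
  define X where "X = T \<times> reduced p S1 \<times> reduced p S2"
  define val where "val = (\<lambda>(t, a, b). t + F * a + G * b)"
  define w where "w x = reduce p (val x)" for x
  \<comment> \<open>Two triples are related by \<open>r\<close> if their polynomial parts differ by
    \<open>r (G, - F)\<close> modulo \<open>p\<close> and their first entries agree.\<close>
  define rel where "rel = (\<lambda>(t :: laurent, a, b) (u, c, d) r. t = u \<and> r \<in> reduced p S3 \<and>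
    of_int p dvd a - c - G * r \<and> of_int p dvd b - d + F * r)"
  have rel: "\<exists>r. rel x y r" if x: "x \<in> X" and y: "y \<in> X" and wxy: "w x = w y" for x y
  proof -
    obtain t a b u c d where xy: "x = (t, a, b)" "y = (u, c, d)"
      by (cases x, cases y)
    have red: "a \<in> reduced p S1" "c \<in> reduced p S1" "b \<in> reduced p S2" "d \<in> reduced p S2"
      and "t \<in> T" "u \<in> T"
      using x y by (auto simp: X_def xy)
    have "of_int p dvd (val x - w x) - (val y - w y)"
      unfolding w_def by (intro dvd_diff dvd_diff_reduce)
    then have "of_int p dvd val x - val y"
      using wxy by simp
    then obtain k where "val x - val y = of_int p * k"
      by (rule dvdE)
    then have k: "t - u + F * (a - c) + G * (b - d) = of_int p * k"
      by (simp add: val_def xy algebra_simps)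
    then have "t - u = F * (c - a) + G * (d - b) + of_int p * k"
      by (simp add: algebra_simps)
    then have "t - u \<in> mod_ideal p F G"
      unfolding mod_ideal_def by blast
    with T \<open>t \<in> T\<close> \<open>u \<in> T\<close> have "t = u"
      by blast
    with k have "of_int p dvd F * (a - c) + G * (b - d)"
      by simp
    then obtain r where r: "of_int p dvd a - c - G * r" "of_int p dvd b - d + F * r"
      using ex by (blast elim: koszul_exactE)
    \<comment> \<open>Modulo \<open>p\<close>, \<open>F * r\<close> equals \<open>d - b\<close>, and
      both of these are supported in \<open>S2\<close>.\<close>
    have "supp p (F * r) \<subseteq> S2"
    proof
      fix e
      assume "e \<in> supp p (F * r)"
      moreover have "p dvd coef b e - coef d e + coef (F * r) e"
        using r(2) unfolding of_int_dvd_iff Poly_Mapping.lookup_add Poly_Mapping.lookup_minus by blast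
      ultimately have "e \<in> supp p b \<or> e \<in> supp p d"
        by (auto simp: supp_def) (metis dvd_add_right_iff dvd_diff)
      then show "e \<in> S2"
        using supp_reduced red by blast
    qed
    then have "reduce p r \<in> reduced p S3"
      by (intro reduce_in_reduced p0 S3)
    moreover have "of_int p dvd (a - c - G * r) + G * (r - reduce p r)"
      "of_int p dvd (b - d + F * r) - F * (r - reduce p r)"
      using r dvd_diff_reduce by (blast intro: dvd_add dvd_diff dvd_mult)+
    ultimately have "rel x y (reduce p r)"
      using \<open>t = u\<close> by (simp add: rel_def xy algebra_simps)
    then show ?thesis
      by blast
  qed
  \<comment> \<open>Each value of \<open>w\<close> gets one chosen preimage. A triple is recovered
    from its value and from the syzygy multiple \<open>\<rho> x\<close> that separates it from that
    preimage, so a fibre has at most as many members as \<open>reduced p S3\<close>.\<close>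
  define base where "base v = (SOME x. x \<in> X \<and> w x = v)" for v
  have base: "base (w x) \<in> X" "w (base (w x)) = w x" if "x \<in> X" for x
    using someI [of "\<lambda>y. y \<in> X \<and> w y = w x" x] that by (auto simp: base_def)
  define \<rho> where "\<rho> x = (SOME r. rel x (base (w x)) r)" for x
  have \<rho>: "rel x (base (w x)) (\<rho> x)" if "x \<in> X" for x
    unfolding \<rho>_def by (rule someI_ex) (use rel that base in auto)
  have "inj_on (\<lambda>x. (w x, \<rho> x)) X"
  proof (rule inj_onI)
    fix x y
    assume x: "x \<in> X" and y: "y \<in> X" and eq: "(w x, \<rho> x) = (w y, \<rho> y)"
    obtain t a b u c d t' a' b' where xy: "x = (t, a, b)" "y = (u, c, d)" "base (w x) = (t', a', b')"
      by (cases x, cases y, cases "base (w x)")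
    have 1: "rel (t, a, b) (t', a', b') (\<rho> x)" and 2: "rel (u, c, d) (t', a', b') (\<rho> x)"
      using \<rho> [OF x] \<rho> [OF y] eq xy by auto
    have "of_int p dvd (a - a' - G * \<rho> x) - (c - a' - G * \<rho> x)"
      by (rule dvd_diff) (use 1 2 in \<open>auto simp: rel_def\<close>)
    moreover have "of_int p dvd (b - b' + F * \<rho> x) - (d - b' + F * \<rho> x)"
      by (rule dvd_diff) (use 1 2 in \<open>auto simp: rel_def\<close>)
    ultimately have "of_int p dvd a - c" "of_int p dvd b - d"
      by (simp_all add: algebra_simps)
    then have "a = c" "b = d"
      using x y by (auto simp: X_def xy intro: reduced_eqI)
    moreover have "t = u"
      using 1 2 by (simp add: rel_def)
    ultimately show "x = y"
      by (simp add: xy)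
  qed
  moreover have "(\<lambda>x. (w x, \<rho> x)) ` X \<subseteq> reduced p S \<times> reduced p S3"
  proof
    fix z
    assume "z \<in> (\<lambda>x. (w x, \<rho> x)) ` X"
    then obtain x where x: "x \<in> X" "z = (w x, \<rho> x)"
      by blast
    obtain t a b where abt: "x = (t, a, b)"
      by (cases x)
    have "t \<in> T" "a \<in> reduced p S1" "b \<in> reduced p S2"
      using x(1) by (simp_all add: X_def abt)
    then have "supp p t \<subseteq> S" "supp p (F * a) \<subseteq> S" "supp p (G * b) \<subseteq> S"
      by (simp_all add: TS S1 S2 supp_reduced)
    then have "supp p (t + F * a + G * b) \<subseteq> S"
      using supp_add [of p "t + F * a" "G * b"] supp_add [of p t "F * a"] by blast
    then have "w x \<in> reduced p S"
      by (simp add: w_def val_def abt reduce_in_reduced p0)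
    moreover have "\<rho> x \<in> reduced p S3"
      using \<rho> [OF x(1)] by (auto simp: rel_def split: prod.splits)
    ultimately show "z \<in> reduced p S \<times> reduced p S3"
      by (simp add: x)
  qed
  ultimately have "card X \<le> card (reduced p S \<times> reduced p S3)"
    using fin p0 by (intro card_inj_on_le) (auto intro: finite_reduced)
  then show ?thesis
    using fin p0 by (simp add: X_def card_cartesian_product card_reduced power_add)
qed

text \<open>Every side of the box is touched by \<open>S\<close>; these extreme points are what
  bounds a factor in terms of the product.\<close>

lemma laurent_bounding_box:
  assumes "finite S" "S \<noteq> {}"
  obtains x0 x1 y0 y1 :: int
  where "S \<subseteq> {x0..x1} \<times> {y0..y1}" "x0 \<in> fst ` S" "x1 \<in> fst ` S" "y0 \<in> snd ` S" "y1 \<in> snd ` S"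
proof
  show "S \<subseteq> {Min (fst ` S)..Max (fst ` S)} \<times> {Min (snd ` S)..Max (snd ` S)}"
    using assms(1) by auto (metis Max_ge Min_le finite_imageI fst_conv snd_conv imageI)+
qed (use assms in \<open>simp_all add: Min_in Max_in\<close>)

text \<open>
  With \<open>w\<^sub>1 \<times> h\<^sub>1\<close> and \<open>w\<^sub>2 \<times> h\<^sub>2\<close> the sides of the bounding boxes of \<open>F\<close> and \<open>G\<close>, the box
  cardinalities combine so that all terms involving \<open>n\<close> cancel and \<open>w\<^sub>1 h\<^sub>2 + w\<^sub>2 h\<^sub>1\<close> remains.
\<close>

lemma incongruent_bound_aux:
  assumes p: "prime p" and ex: "koszul_exact p F G" and F: "\<not> of_int p dvd F"
  shows "\<exists>B. \<forall>T. finite T \<longrightarrow> (\<forall>t\<in>T. \<forall>u\<in>T. t - u \<in> mod_ideal p F G \<longrightarrow> t = u) \<longrightarrow> card T \<le> B"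
proof -
  obtain x0 x1 y0 y1 where Fbox: "supp p F \<subseteq> {x0..x1} \<times> {y0..y1}"
      "x0 \<in> fst ` supp p F" "x1 \<in> fst ` supp p F" "y0 \<in> snd ` supp p F" "y1 \<in> snd ` supp p F"
    using laurent_bounding_box [of "supp p F"] F supp_eq_empty_iff by (metis finite_supp)
  \<comment> \<open>Inserting the origin keeps the box nonempty even if \<open>G\<close> vanishes
    modulo \<open>p\<close>.\<close>
  obtain u0 u1 v0 v1 where Gbox: "insert (0, 0) (supp p G) \<subseteq> {u0..u1} \<times> {v0..v1}"
    using laurent_bounding_box [of "insert (0, 0) (supp p G)"] by (metis finite_insert finite_supp insert_not_empty)
  have widths: "x0 \<le> x1" "y0 \<le> y1" "u0 \<le> u1" "v0 \<le> v1"
    using Fbox Gbox by force+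
  define w1 h1 w2 h2 where "w1 = x1 - x0" and "h1 = y1 - y0" and "w2 = u1 - u0" and "h2 = v1 - v0"
  define C where "C = nat (w1 * h2 + w2 * h1)"
  have C: "int C = w1 * h2 + w2 * h1"
    using widths by (simp add: C_def w1_def w2_def h1_def h2_def)
  have "card T \<le> nat p ^ C"
    if T: "finite T" "\<forall>t\<in>T. \<forall>u\<in>T. t - u \<in> mod_ideal p F G \<longrightarrow> t = u" for T
  proof -
    define E where "E = (\<Union>t\<in>T. supp p t)"
    have "finite E"
      using T by (simp add: E_def)
    \<comment> \<open>Large enough for the square of radius \<open>n\<close> to contain all supports
      of \<open>T\<close>, and for the shrunken boxes below to have nonnegative sides. The final
      bound is independent of \<open>n\<close>, hence of \<open>T\<close>.\<close>
    define n where "n = (\<Sum>e\<in>E. \<bar>fst e\<bar> + \<bar>snd e\<bar>) + w1 + w2 + h1 + h2"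
    have "(\<Sum>e\<in>E. \<bar>fst e\<bar> + \<bar>snd e\<bar>) \<ge> 0"
      by (rule sum_nonneg) auto
    then have n: "n \<ge> w1 + w2" "n \<ge> h1 + h2" "n \<ge> 0"
      using widths by (auto simp: n_def w1_def w2_def h1_def h2_def)
    have nE: "\<bar>fst e\<bar> \<le> n \<and> \<bar>snd e\<bar> \<le> n" if "e \<in> E" for e
    proof -
      have "\<bar>fst e\<bar> + \<bar>snd e\<bar> \<le> (\<Sum>e\<in>E. \<bar>fst e\<bar> + \<bar>snd e\<bar>)"
        by (rule member_le_sum) (use that \<open>finite E\<close> in auto)
      then show ?thesis
        using widths by (auto simp: n_def w1_def w2_def h1_def h2_def)
    qed
    define S where "S = {-n..n} \<times> {-n..n}"
    \<comment> \<open>For \<open>a\<close> supported in \<open>S1\<close> the product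
      \<open>F * a\<close> stays inside \<open>S\<close>, likewise \<open>G * b\<close> for
      \<open>b\<close> supported in \<open>S2\<close>. The box \<open>S3\<close> confines every
      \<open>r\<close> for which \<open>F * r\<close> is supported in \<open>S2\<close>.\<close>
    define S1 where "S1 = {-n-x0..n-x1} \<times> {-n-y0..n-y1}"
    define S2 where "S2 = {-n-u0..n-u1} \<times> {-n-v0..n-v1}"
    define S3 where "S3 = {-n-u0-x0..n-u1-x1} \<times> {-n-v0-y0..n-v1-y1}"
    have "card T * nat p ^ (card S1 + card S2) \<le> nat p ^ (card S + card S3)"
    proof (rule incongruent_count [OF p ex])
      show "finite S" "finite S1" "finite S2" "finite S3"
        by (simp_all add: S_def S1_def S2_def S3_def)
      show "supp p t \<subseteq> S" if "t \<in> T" for t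
      proof
        fix e
        assume "e \<in> supp p t"
        with that have "e \<in> E"
          by (auto simp: E_def)
        from nE [OF this] show "e \<in> S"
          by (cases e) (auto simp: S_def)
      qed
      show "supp p (F * a) \<subseteq> S" if "supp p a \<subseteq> S1" for a
      proof
        fix e
        assume "e \<in> supp p (F * a)"
        then obtain d where "d \<in> supp p F" "e - d \<in> supp p a"
          by (rule supp_mult)
        then have "d \<in> {x0..x1} \<times> {y0..y1}" "e - d \<in> S1"
          using Fbox that by blast+
        then show "e \<in> S"
          by (cases e, cases d) (auto simp: S_def S1_def)
      qed
      show "supp p (G * b) \<subseteq> S" if "supp p b \<subseteq> S2" for b
      proof
        fix e
        assume "e \<in> supp p (G * b)"
        then obtain d where "d \<in> supp p G" "e - d \<in> supp p b"
          by (rule supp_mult)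
        then have "d \<in> {u0..u1} \<times> {v0..v1}" "e - d \<in> S2"
          using Gbox that by blast+
        then show "e \<in> S"
          by (cases e, cases d) (auto simp: S_def S2_def)
      qed
      show "supp p r \<subseteq> S3" if r: "supp p (F * r) \<subseteq> S2" for r
      proof
        fix s
        assume s: "s \<in> supp p r"
        obtain t1 t2 t3 t4 where t: "t1 \<in> supp p F" "fst t1 = x0" "t2 \<in> supp p F" "fst t2 = x1"
            "t3 \<in> supp p F" "snd t3 = y0" "t4 \<in> supp p F" "snd t4 = y1"
          using Fbox by auto
        \<comment> \<open>Taking \<open>l\<close> to be plus or minus a coordinate pushes a point of
          \<open>r\<close> by an extreme point of \<open>F\<close> towards each of the four sides of
          \<open>S2\<close>; the other coordinate breaks ties.\<close>
        have "\<exists>z\<in>supp p (F * r). - fst t1 + - fst s \<le> - fst z"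
          by (rule supp_mult_extent [where m = snd]) (use p t s in \<open>auto simp: prod_eq_iff\<close>)
        moreover have "\<exists>z\<in>supp p (F * r). fst t2 + fst s \<le> fst z"
          by (rule supp_mult_extent [where m = snd]) (use p t s in \<open>auto simp: prod_eq_iff\<close>)
        moreover have "\<exists>z\<in>supp p (F * r). - snd t3 + - snd s \<le> - snd z"
          by (rule supp_mult_extent [where m = fst]) (use p t s in \<open>auto simp: prod_eq_iff\<close>)
        moreover have "\<exists>z\<in>supp p (F * r). snd t4 + snd s \<le> snd z"
          by (rule supp_mult_extent [where m = fst]) (use p t s in \<open>auto simp: prod_eq_iff\<close>)
        ultimately have "- n - u0 \<le> x0 + fst s" "x1 + fst s \<le> n - u1"
          "- n - v0 \<le> y0 + snd s" "y1 + snd s \<le> n - v1"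
          using r t unfolding S2_def by fastforce+
        then show "s \<in> S3"
          by (cases s) (auto simp: S3_def)
      qed
    qed (use T in auto)
    \<comment> \<open>With \<open>A = 2 n + 1\<close> this is the identity \<open>A * A + (A - w1 -
      w2) * (A - h1 - h2) = (A - w1) * (A - h1) + (A - w2) * (A - h2) + w1 * h2 + w2 *
      h1\<close>.\<close>
    moreover have "card S + card S3 = card S1 + card S2 + C"
    proof -
      have box: "int (card ({a..b} \<times> {c..d})) = (b - a + 1) * (d - c + 1)"
        if "a \<le> b + 1" "c \<le> d + 1" for a b c d :: int
        using that by (simp add: card_cartesian_product)
      have "int (card S + card S3) = int (card S1 + card S2 + C)"
        using n widths unfolding S_def S1_def S2_def S3_def of_nat_add C w1_def w2_def h1_def h2_def
        by (subst box box box box; simp)+ (simp add: algebra_simps)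
      then show ?thesis
        by linarith
    qed
    ultimately have "card T * nat p ^ (card S1 + card S2) \<le> nat p ^ C * nat p ^ (card S1 + card S2)"
      by (simp add: power_add mult.commute)
    then show ?thesis
      using p prime_gt_0_int by simp
  qed
  then show ?thesis
    by blast
qed

lemma mod_ideal_sym: "mod_ideal m F G = mod_ideal m G F"
proof -
  have "mod_ideal m F G \<subseteq> mod_ideal m G F" for F G
    unfolding mod_ideal_def by (auto, metis add.commute)
  then show ?thesis
    by blast
qed

text \<open>A uniform bound on pairwise incongruent finite sets expresses finiteness of the quotient
  without forming it. Exactness modulo \<open>p\<close> provides a generator that is nonzero modulo
  \<open>p\<close>, and symmetry lets it play the part of \<open>F\<close>.\<close>

lemma incongruent_bound:
  assumes p: "prime p" and ex: "koszul_exact p F G"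
  shows "\<exists>B. \<forall>T. finite T \<longrightarrow> (\<forall>t\<in>T. \<forall>u\<in>T. t - u \<in> mod_ideal p F G \<longrightarrow> t = u) \<longrightarrow> card T \<le> B"
proof (cases "of_int p dvd F")
  case False
  then show ?thesis
    by (rule incongruent_bound_aux [OF assms])
next
  case True
  then have "\<not> of_int p dvd G"
    using koszul_exact_not_both_zero [of p 1 F G] p ex by simp
  then show ?thesis
    using incongruent_bound_aux [OF p koszul_exact_sym [OF ex]] mod_ideal_sym [of p F G] by simp
qed

section \<open>Bases of quotients\<close>

text \<open>If \<open>of_int p\<close> lies in \<open>I\<close>, this says that the classes of
  \<open>e 0, ..., e (d - 1)\<close> freely generate the quotient by \<open>I\<close> over the
  integers modulo \<open>p\<close>. Integer coefficients allow the same \<open>e\<close> to be used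
  for a prime and for its powers.\<close>

definition residue_basis :: "int \<Rightarrow> 'a :: comm_ring_1 set \<Rightarrow> nat \<Rightarrow> (nat \<Rightarrow> 'a) \<Rightarrow> bool" where
  "residue_basis p I d e \<longleftrightarrow>
    (\<forall>h. \<exists>c :: nat \<Rightarrow> int. h - (\<Sum>j<d. of_int (c j) * e j) \<in> I) \<and>
    (\<forall>c :: nat \<Rightarrow> int. (\<Sum>j<d. of_int (c j) * e j) \<in> I \<longrightarrow> (\<forall>j<d. p dvd c j))"

lemma residue_basis_span:
  assumes "residue_basis p I d e"
  shows "\<exists>c :: nat \<Rightarrow> int. h - (\<Sum>j<d. of_int (c j) * e j) \<in> I"
  using assms unfolding residue_basis_def by blast

lemma residue_basis_indep:
  fixes c :: "nat \<Rightarrow> int"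
  assumes "residue_basis p I d e" "(\<Sum>j<d. of_int (c j) * e j) \<in> I" "j < d"
  shows "p dvd c j"
  using assms unfolding residue_basis_def by blast

text \<open>An independent family of length \<open>d\<close> yields \<open>p ^ d\<close> incongruent
  combinations, so lengths are bounded and a longest family exists. Appending any \<open>h\<close>
  to it creates a relation in which the coefficient of \<open>h\<close> is invertible modulo
  \<open>p\<close>, and solving for \<open>h\<close> shows that the family spans.\<close>

lemma residue_basis_exists:
  fixes I :: "'a :: comm_ring_1 set"
  assumes p: "prime p" and I: "ring_ideal I" "of_int p \<in> I"
    and bound: "\<And>T. finite T \<Longrightarrow> (\<forall>t\<in>T. \<forall>u\<in>T. t - u \<in> I \<longrightarrow> t = u) \<Longrightarrow> card T \<le> B"
  shows "\<exists>d e. residue_basis p I d e"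
proof -
  have p0: "p > 1"
    using p prime_gt_1_int by blast
  define indep where "indep d \<longleftrightarrow> (\<exists>e :: nat \<Rightarrow> 'a. \<forall>c :: nat \<Rightarrow> int.
    (\<Sum>j<d. of_int (c j) * e j) \<in> I \<longrightarrow> (\<forall>j<d. p dvd c j))" for d
  have "d \<le> B" if "indep d" for d
  proof -
    obtain e :: "nat \<Rightarrow> 'a" where e: "\<And>c :: nat \<Rightarrow> int. (\<Sum>j<d. of_int (c j) * e j) \<in> I \<Longrightarrow> \<forall>j<d. p dvd c j"
      using \<open>indep d\<close> unfolding indep_def by blast
    define X where "X = {..<d} \<rightarrow>\<^sub>E {0..<p}"
    define val where "val c = (\<Sum>j<d. of_int (c j) * e j)" for c :: "nat \<Rightarrow> int"
    have inj: "c = c'" if "c \<in> X" "c' \<in> X" "val c - val c' \<in> I" for c c'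
    proof -
      have "val c - val c' = (\<Sum>j<d. of_int (c j - c' j) * e j)"
        by (simp add: val_def left_diff_distrib sum_subtractf)
      then have dv: "\<forall>j<d. p dvd c j - c' j"
        using e [of "\<lambda>j. c j - c' j"] that by auto
      show ?thesis
      proof (rule PiE_ext)
        show "c j = c' j" if "j \<in> {..<d}" for j
        proof -
          have "c j mod p = c' j mod p"
            using dv that by (simp add: mod_eq_dvd_iff)
          then show ?thesis
            using that \<open>c \<in> X\<close> \<open>c' \<in> X\<close> by (auto simp: X_def PiE_iff)
        qed
      qed (use that in \<open>auto simp: X_def\<close>)
    qed
    have "finite X"
      by (auto simp: X_def intro: finite_PiE)
    have "inj_on val X"
      by (rule inj_onI, rule inj) (simp_all add: ring_ideal_zero I)
    then have "card (val ` X) = nat p ^ d"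
      by (simp add: card_image X_def card_PiE)
    moreover have "card (val ` X) \<le> B"
      by (rule bound) (use inj \<open>finite X\<close> in auto)
    \<comment> \<open>Exponential growth lets \<open>B\<close> itself bound the lengths.\<close>
    moreover have "d < nat p ^ d"
      using p0 by (intro power_gt_expt) auto
    ultimately show ?thesis
      by linarith
  qed
  moreover have "indep 0"
    by (simp add: indep_def)
  ultimately obtain d where d: "indep d" "\<And>d'. indep d' \<Longrightarrow> d' \<le> d"
    using Nat.ex_has_greatest_nat [of indep 0 B] by blast
  then obtain e :: "nat \<Rightarrow> 'a" where e: "\<And>c :: nat \<Rightarrow> int. (\<Sum>j<d. of_int (c j) * e j) \<in> I \<Longrightarrow> \<forall>j<d. p dvd c j"
    unfolding indep_def by blast
  have "\<exists>c :: nat \<Rightarrow> int. h - (\<Sum>j<d. of_int (c j) * e j) \<in> I" for h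
  proof -
    have "\<not> indep (Suc d)"
      using d(2) by fastforce
    then obtain c :: "nat \<Rightarrow> int" where "(\<Sum>j<Suc d. of_int (c j) * (e(d := h)) j) \<in> I"
        and ndv: "\<not> (\<forall>j<Suc d. p dvd c j)"
      unfolding indep_def by blast
    then have c: "(\<Sum>j<d. of_int (c j) * e j) + of_int (c d) * h \<in> I"
      by simp
    \<comment> \<open>As \<open>p\<close> lies in \<open>I\<close>, a coefficient of
      \<open>h\<close> divisible by \<open>p\<close> could be dropped, leaving a relation among the
      \<open>e j\<close> alone; then all coefficients would be divisible by
      \<open>p\<close>.\<close>
    have "\<not> p dvd c d"
    proof
      assume "p dvd c d"
      then have "of_int (c d) * h \<in> I"
        by (intro ring_ideal_dvd [OF I] dvd_mult2 of_int_dvd_of_int)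
      then have "(\<Sum>j<d. of_int (c j) * e j) \<in> I"
        using ring_ideal_diff [OF I(1) c] by (metis add_diff_cancel_right')
      with e have "\<forall>j<d. p dvd c j"
        by blast
      with ndv \<open>p dvd c d\<close> show False
        by (auto simp: less_Suc_eq)
    qed
    then have "coprime p (c d)"
      using p by (rule prime_imp_coprime [rotated])
    then obtain u v where "u * p + v * c d = 1"
      using bezout_int [of p "c d"] by auto
    then have "of_int (u * p + v * c d) = (1 :: 'a)"
      by simp
    then have uv: "of_int u * of_int p + of_int v * of_int (c d) = (1 :: 'a)"
      by simp
    have "h - (\<Sum>j<d. of_int (- v * c j) * e j) =
        (of_int u * of_int p + of_int v * of_int (c d)) * h + (\<Sum>j<d. of_int v * (of_int (c j) * e j))"
      by (simp add: uv sum_negf mult.assoc)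
    also have "\<dots> = (of_int u * h) * of_int p + of_int v * ((\<Sum>j<d. of_int (c j) * e j) + of_int (c d) * h)"
      by (simp add: algebra_simps sum_distrib_left)
    also have "\<dots> \<in> I"
      by (rule ring_ideal_add [OF I(1) ring_ideal_mult [OF I] ring_ideal_mult [OF I(1) c]])
    finally show ?thesis
      by (rule exI [of _ "\<lambda>j. - v * c j"])
  qed
  with e have "residue_basis p I d e"
    unfolding residue_basis_def by blast
  then show ?thesis
    by (intro exI)
qed

text \<open>For an ideal containing \<open>N\<close>, adding a divisor \<open>m\<close> of
  \<open>N\<close> passes from the quotient modulo \<open>N\<close> to the one modulo
  \<open>m\<close>.\<close>

definition ideal_plus :: "'a :: comm_ring_1 set \<Rightarrow> int \<Rightarrow> 'a set" where
  "ideal_plus K m = {x + of_int m * c | x c. x \<in> K}"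

lemma ideal_plusI: "x \<in> K \<Longrightarrow> a = x + of_int m * c \<Longrightarrow> a \<in> ideal_plus K m"
  by (auto simp: ideal_plus_def)

lemma ideal_plusE:
  assumes "a \<in> ideal_plus K m"
  obtains x c where "x \<in> K" "a = x + of_int m * c"
  using assms by (auto simp: ideal_plus_def)

lemma ring_ideal_plus:
  assumes "ring_ideal K"
  shows "ring_ideal (ideal_plus K m)"
  unfolding ring_ideal_def
proof (intro conjI ballI allI)
  show "0 \<in> ideal_plus K m"
    by (rule ideal_plusI [of 0 _ _ _ 0]) (simp_all add: ring_ideal_zero assms)
next
  fix a b
  assume "a \<in> ideal_plus K m" "b \<in> ideal_plus K m"
  then obtain x c y d where "x \<in> K" "a = x + of_int m * c" "y \<in> K" "b = y + of_int m * d"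
    by (auto elim!: ideal_plusE)
  then show "a + b \<in> ideal_plus K m"
    by (intro ideal_plusI [of "x + y" _ _ _ "c + d"]) (auto simp: algebra_simps ring_ideal_add assms)
next
  fix r a
  assume "a \<in> ideal_plus K m"
  then obtain x c where "x \<in> K" "a = x + of_int m * c"
    by (auto elim!: ideal_plusE)
  then show "r * a \<in> ideal_plus K m"
    by (intro ideal_plusI [of "r * x" _ _ _ "r * c"]) (auto simp: algebra_simps ring_ideal_mult assms)
qed

lemma ideal_plus_superset: "a \<in> K \<Longrightarrow> a \<in> ideal_plus K m"
  by (rule ideal_plusI [of _ _ _ _ 0]) simp_all

lemma ideal_plus_multiple:
  assumes "ring_ideal K" "of_int m dvd a"
  shows "a \<in> ideal_plus K m"
  using assms(2) by (elim dvdE) (rule ideal_plusI [of 0], simp_all add: ring_ideal_zero assms)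

text \<open>Spanning is successive approximation: an error \<open>of_int (p ^ t) * h'\<close> is
  improved by expanding \<open>h'\<close> modulo \<open>p\<close>. Independence runs the other way,
  with flatness extracting one factor \<open>p\<close> at a time from the coefficients.\<close>

lemma residue_basis_prime_power:
  fixes K :: "'a :: comm_ring_1 set"
  assumes K: "ring_ideal K" and k: "k \<ge> 1"
    and basis: "residue_basis p (ideal_plus K p) d e"
    and flat: "\<And>h. of_int (p ^ (k - 1)) * h \<in> ideal_plus K (p ^ k) \<Longrightarrow> h \<in> ideal_plus K p"
  shows "residue_basis (p ^ k) (ideal_plus K (p ^ k)) d e"
proof -
  have "\<exists>c :: nat \<Rightarrow> int. h - (\<Sum>j<d. of_int (c j) * e j) \<in> ideal_plus K (p ^ t)" for h t
  proof (induction t)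
    case 0
    show ?case
      by (rule exI [of _ "\<lambda>_. 0"]) (simp add: ideal_plus_multiple K)
  next
    case (Suc t)
    then obtain c :: "nat \<Rightarrow> int" and x h'
      where c: "x \<in> K" "h - (\<Sum>j<d. of_int (c j) * e j) = x + of_int (p ^ t) * h'"
      by (auto elim!: ideal_plusE)
    obtain c' :: "nat \<Rightarrow> int" where "h' - (\<Sum>j<d. of_int (c' j) * e j) \<in> ideal_plus K p"
      using basis unfolding residue_basis_def by blast
    then obtain x' h'' where c': "x' \<in> K" "h' - (\<Sum>j<d. of_int (c' j) * e j) = x' + of_int p * h''"
      by (rule ideal_plusE)
    have "h - (\<Sum>j<d. of_int (c j + p ^ t * c' j) * e j) =
        (h - (\<Sum>j<d. of_int (c j) * e j)) - of_int (p ^ t) * (\<Sum>j<d. of_int (c' j) * e j)"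
      by (simp add: distrib_right sum.distrib sum_distrib_left mult.assoc)
    also have "\<dots> = x + of_int (p ^ t) * (h' - (\<Sum>j<d. of_int (c' j) * e j))"
      unfolding c(2) by (simp add: algebra_simps)
    also have "\<dots> = (x + of_int (p ^ t) * x') + of_int (p ^ Suc t) * h''"
      unfolding c'(2) by (simp add: algebra_simps)
    also have "\<dots> \<in> ideal_plus K (p ^ Suc t)"
      using K c(1) c'(1) by (intro ideal_plusI [OF _ refl]) (auto intro: ring_ideal_add ring_ideal_mult)
    finally show ?case
      by (rule exI [of _ "\<lambda>j. c j + p ^ t * c' j"])
  qed
  moreover have "\<forall>j<d. p ^ k dvd c j"
    if c: "(\<Sum>j<d. of_int (c j) * e j) \<in> ideal_plus K (p ^ k)" for c :: "nat \<Rightarrow> int"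
  proof -
    have "\<forall>j<d. p ^ t dvd c j" if "t \<le> k" for t
      using that
    proof (induction t)
      case (Suc t)
      then have "\<forall>j. \<exists>c'. j < d \<longrightarrow> c j = p ^ t * c'"
        by (auto elim!: dvdE)
      then obtain c' where c': "\<And>j. j < d \<Longrightarrow> c j = p ^ t * c' j"
        by metis
      \<comment> \<open>The multiplier tops up the factor \<open>p ^ t\<close> of the coefficients
        to exactly \<open>p ^ (k - 1)\<close>, the power at which \<open>flat\<close>
        applies.\<close>
      have "of_int (p ^ (k - 1 - t)) * (\<Sum>j<d. of_int (c j) * e j) \<in> ideal_plus K (p ^ k)"
        using c K ring_ideal_plus ring_ideal_mult by blast
      also have "of_int (p ^ (k - 1 - t)) * (\<Sum>j<d. of_int (c j) * e j) =
          of_int (p ^ (k - 1 - t) * p ^ t) * (\<Sum>j<d. of_int (c' j) * e j)"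
        unfolding sum_distrib_left by (rule sum.cong) (simp_all add: c' ac_simps)
      also have "p ^ (k - 1 - t) * p ^ t = p ^ (k - 1)"
        using Suc.prems by (simp flip: power_add)
      finally have "(\<Sum>j<d. of_int (c' j) * e j) \<in> ideal_plus K p"
        by (rule flat)
      with basis have "\<forall>j<d. p dvd c' j"
        unfolding residue_basis_def by blast
      then show ?case
        by (auto simp: c' mult.commute [of p])
    qed simp
    then show ?thesis
      by blast
  qed
  ultimately show ?thesis
    unfolding residue_basis_def by blast
qed

section \<open>Gluing the primary parts\<close>

lemma carrier_sum_group_finite:
  assumes "finite I" "\<And>i. i \<in> I \<Longrightarrow> group (G i)"
  shows "carrier (sum_group I G) = (\<Pi>\<^sub>E i\<in>I. carrier (G i))"
  using assms by (auto simp: carrier_sum_group)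

text \<open>A single explicit map does the Chinese remaindering: coordinates \<open>c i j\<close> go
  to the combination of the \<open>e i j\<close> in which block \<open>i\<close> is weighted by the
  cofactor \<open>m i\<close> of \<open>q i\<close>. Changing \<open>c i j\<close> by a multiple of
  \<open>q i\<close> changes the combination by a multiple of the full product, which lies in
  \<open>K\<close>.\<close>

lemma iso_sum_integer_mod_groups:
  fixes K :: "'a :: comm_ring_1 set" and q d :: "nat \<Rightarrow> nat"
    and M :: "('b, 'm) ring_scheme" and \<rho> :: "'a \<Rightarrow> 'b"
  assumes K: "ring_ideal K" and J: "finite J"
    and q0: "\<And>i. i \<in> J \<Longrightarrow> q i > 0"
    and cop: "\<And>i j. i \<in> J \<Longrightarrow> j \<in> J \<Longrightarrow> i \<noteq> j \<Longrightarrow> coprime (q i) (q j)"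
    and N: "of_nat (prod q J) \<in> K"
    and basis: "\<And>i. i \<in> J \<Longrightarrow> residue_basis (int (q i)) (ideal_plus K (int (q i))) (d i) (e i)"
    and \<rho>: "carrier M = range \<rho>" "\<And>a b. \<rho> (a + b) = \<rho> a \<oplus>\<^bsub>M\<^esub> \<rho> b"
      "\<And>a b. \<rho> a = \<rho> b \<longleftrightarrow> a - b \<in> K"
  shows "add_monoid M \<cong> sum_group J (\<lambda>i. sum_group {..<d i} (\<lambda>_. integer_mod_group (q i)))"
    (is "_ \<cong> ?G")
proof -
  define m where "m i = int (prod q (J - {i}))" for i
  have mq: "m i * int (q i) = int (prod q J)" if "i \<in> J" for i
    using that J by (simp add: m_def prod.remove [of J i] mult.commute)
  have qm: "int (q i) dvd m l" if "i \<in> J" "l \<noteq> i" for i l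
    using that J unfolding m_def of_nat_dvd_iff by (intro dvd_prodI) auto
  have copm: "coprime (m i) (int (q i))" if "i \<in> J" for i
    unfolding m_def coprime_int_iff using that cop by (intro prod_coprime_left) auto
  have Nmult: "of_int c * a \<in> K" if "int (prod q J) dvd c" for c and a :: 'a
  proof -
    obtain c' where "c = int (prod q J) * c'"
      using \<open>int (prod q J) dvd c\<close> by (rule dvdE)
    then have "of_int c * a = (of_int c' * a) * of_nat (prod q J)"
      by (simp add: ac_simps del: of_nat_prod)
    with N K show ?thesis
      by (simp only: ring_ideal_mult)
  qed
  define val where "val c = (\<Sum>i\<in>J. \<Sum>j<d i. of_int (m i * c i j) * e i j)" for c :: "nat \<Rightarrow> nat \<Rightarrow> int"
  have val_cong: "val c - val c' \<in> K"
    if "\<And>i j. i \<in> J \<Longrightarrow> j < d i \<Longrightarrow> int (q i) dvd c i j - c' i j" for c c'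
  proof -
    have "val c - val c' = (\<Sum>i\<in>J. \<Sum>j<d i. of_int (m i * (c i j - c' i j)) * e i j)"
      by (simp add: val_def algebra_simps sum_subtractf)
    also have "\<dots> \<in> K"
      using K
    proof (intro ring_ideal_sum Nmult)
      show "int (prod q J) dvd m i * (c i j - c' i j)" if "i \<in> J" "j \<in> {..<d i}" for i j
        unfolding mq [OF \<open>i \<in> J\<close>, symmetric] using that
          \<open>\<And>i j. i \<in> J \<Longrightarrow> j < d i \<Longrightarrow> int (q i) dvd c i j - c' i j\<close>
        by (intro mult_dvd_mono) auto
    qed
    finally show ?thesis .
  qed
  have val_in_K: "int (q l) dvd c l j" if c: "val c \<in> K" and l: "l \<in> J" and j: "j < d l" for c l j
  proof -
    let ?I = "ideal_plus K (int (q l))"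
    have I: "ring_ideal ?I"
      by (rule ring_ideal_plus [OF K])
    \<comment> \<open>Modulo \<open>q l\<close> all blocks other than \<open>l\<close> vanish,
      because \<open>q l\<close> divides their cofactors. What remains is \<open>s\<close> times
      \<open>m l\<close>, and \<open>m l\<close> is invertible modulo \<open>q l\<close>.\<close>
    define s where "s = (\<Sum>j<d l. of_int (c l j) * e l j)"
    define r where "r = (\<Sum>i\<in>J - {l}. \<Sum>j<d i. of_int (m i * c i j) * e i j)"
    have "val c = (\<Sum>j<d l. of_int (m l * c l j) * e l j) + r"
      unfolding val_def r_def using J l by (rule sum.remove)
    also have "(\<Sum>j<d l. of_int (m l * c l j) * e l j) = of_int (m l) * s"
      by (simp add: s_def sum_distrib_left mult.assoc)
    finally have "of_int (m l) * s = val c - r"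
      by simp
    moreover have "r \<in> ?I"
      unfolding r_def
    proof (rule ring_ideal_sum [OF I], rule ring_ideal_sum [OF I], rule ideal_plus_multiple [OF K])
      show "of_int (int (q l)) dvd of_int (m i * c i j) * e i j" if "i \<in> J - {l}" for i j
      proof -
        have "(of_int (int (q l)) :: 'a) dvd of_int (m i)"
          using qm [OF l, of i] that by (intro of_int_dvd_of_int) auto
        then show ?thesis
          by (simp add: mult.assoc)
      qed
    qed
    ultimately have ms: "of_int (m l) * s \<in> ?I"
      using ideal_plus_superset [OF c] ring_ideal_diff [OF I] by simp
    obtain u v where "u * m l + v * int (q l) = 1"
      using bezout_int [of "m l" "int (q l)"] copm [OF l] by auto
    then have "of_int (u * m l + v * int (q l)) = (1 :: 'a)"
      by simp
    then have "s = of_int u * (of_int (m l) * s) + of_int (int (q l)) * (of_int v * s)"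
      by (metis (no_types, opaque_lifting) distrib_right mult.assoc mult.commute mult.left_neutral of_int_add of_int_mult)
    also have "\<dots> \<in> ?I"
      by (intro ring_ideal_add [OF I] ring_ideal_mult [OF I] ms ideal_plus_multiple [OF K]) simp
    finally show ?thesis
      using basis [OF l] j unfolding residue_basis_def s_def by blast
  qed
  have grp: "group (sum_group {..<d i} (\<lambda>_. integer_mod_group (q i)))" for i
    by simp
  have carr: "x \<in> carrier ?G \<longleftrightarrow> x \<in> (\<Pi>\<^sub>E i\<in>J. {..<d i} \<rightarrow>\<^sub>E {0..<int (q i)})" for x
    using J q0 by (simp add: carrier_sum_group_finite carrier_integer_mod_group PiE_iff) blast
  have mult: "(x \<otimes>\<^bsub>?G\<^esub> y) i j = (x i j + y i j) mod int (q i)" if "i \<in> J" "j < d i" for x y i j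
    using that q0 [of i] by (simp add: mult_integer_mod_group)
  have "(\<lambda>x. \<rho> (val x)) \<in> iso ?G (add_monoid M)"
  proof (rule isoI)
    show "(\<lambda>x. \<rho> (val x)) \<in> hom ?G (add_monoid M)"
    proof (rule homI)
      fix x y
      have "val (x \<otimes>\<^bsub>?G\<^esub> y) - val (\<lambda>i j. x i j + y i j) \<in> K"
        by (rule val_cong) (simp only: mult mod_eq_dvd_iff [symmetric] mod_mod_trivial)
      then have "\<rho> (val (x \<otimes>\<^bsub>?G\<^esub> y)) = \<rho> (val (\<lambda>i j. x i j + y i j))"
        by (simp only: \<rho>)
      also have "val (\<lambda>i j. x i j + y i j) = val x + val y"
        by (simp add: val_def algebra_simps sum.distrib)
      also have "\<rho> (val x + val y) = \<rho> (val x) \<otimes>\<^bsub>add_monoid M\<^esub> \<rho> (val y)"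
        by (simp add: \<rho>(2))
      finally show "\<rho> (val (x \<otimes>\<^bsub>?G\<^esub> y)) = \<rho> (val x) \<otimes>\<^bsub>add_monoid M\<^esub> \<rho> (val y)" .
    qed (use \<rho>(1) in auto)
    show "bij_betw (\<lambda>x. \<rho> (val x)) (carrier ?G) (carrier (add_monoid M))"
      unfolding bij_betw_def
    proof
      show "inj_on (\<lambda>x. \<rho> (val x)) (carrier ?G)"
      proof (rule inj_onI)
        fix x y
        assume x: "x \<in> carrier ?G" and y: "y \<in> carrier ?G" and "\<rho> (val x) = \<rho> (val y)"
        then have "val x - val y \<in> K"
          by (simp add: \<rho>)
        moreover have "val x - val y = val (\<lambda>i j. x i j - y i j)"
          by (simp add: val_def algebra_simps sum_subtractf)
        ultimately have "val (\<lambda>i j. x i j - y i j) \<in> K"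
          by simp
        then have dv: "int (q i) dvd x i j - y i j" if "i \<in> J" "j < d i" for i j
          using val_in_K that by blast
        have xy: "x i \<in> {..<d i} \<rightarrow>\<^sub>E {0..<int (q i)}" "y i \<in> {..<d i} \<rightarrow>\<^sub>E {0..<int (q i)}" if "i \<in> J" for i
          using x y that unfolding carr by (blast dest: PiE_mem)+
        show "x = y"
        proof (rule PiE_ext)
          show "x \<in> (\<Pi>\<^sub>E i\<in>J. {..<d i} \<rightarrow>\<^sub>E {0..<int (q i)})" "y \<in> (\<Pi>\<^sub>E i\<in>J. {..<d i} \<rightarrow>\<^sub>E {0..<int (q i)})"
            using x y unfolding carr .
          show "x i = y i" if i: "i \<in> J" for i
          proof (rule PiE_ext [OF xy [OF i]])
            fix j
            assume j: "j \<in> {..<d i}"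
            have "x i j mod int (q i) = y i j mod int (q i)"
              using dv [OF i, of j] j by (simp add: mod_eq_dvd_iff)
            moreover have "x i j \<in> {0..<int (q i)}" "y i j \<in> {0..<int (q i)}"
              using xy [OF i] j by (blast dest: PiE_mem)+
            ultimately show "x i j = y i j"
              by simp
          qed
        qed
      qed
      have "\<rho> h \<in> (\<lambda>x. \<rho> (val x)) ` carrier ?G" for h
      proof -
        have "\<forall>i. \<exists>c :: nat \<Rightarrow> int. i \<in> J \<longrightarrow> h - (\<Sum>j<d i. of_int (c j) * e i j) \<in> ideal_plus K (int (q i))"
          using basis unfolding residue_basis_def by blast
        then obtain c :: "nat \<Rightarrow> nat \<Rightarrow> int" where c: "\<And>i. i \<in> J \<Longrightarrow>
            h - (\<Sum>j<d i. of_int (c i j) * e i j) \<in> ideal_plus K (int (q i))"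
          by metis
        have "\<forall>i. \<exists>u. i \<in> J \<longrightarrow> int (q i) dvd 1 - m i * u"
        proof (intro allI)
          fix i
          show "\<exists>u. i \<in> J \<longrightarrow> int (q i) dvd 1 - m i * u"
          proof (cases "i \<in> J")
            case True
            then obtain u v where "u * m i + v * int (q i) = 1"
              using bezout_int [of "m i" "int (q i)"] copm by auto
            then have "1 - m i * u = int (q i) * v"
              by (simp add: algebra_simps)
            then show ?thesis
              by (metis dvd_triv_left)
          qed simp
        qed
        then obtain u where u: "\<And>i. i \<in> J \<Longrightarrow> int (q i) dvd 1 - m i * u i"
          by metis
        \<comment> \<open>The products \<open>m i * u i\<close> are the orthogonal idempotents: 1
          modulo \<open>q i\<close> and 0 modulo the other factors. They split \<open>h\<close> into
          parts that can be expanded separately.\<close>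
        have "[1 = (\<Sum>i\<in>J. m i * u i)] (mod (\<Prod>i\<in>J. int (q i)))"
        proof (rule cong_cong_prod_coprime, safe)
          fix l
          assume l: "l \<in> J"
          have "int (q l) dvd (\<Sum>i\<in>J - {l}. m i * u i)"
            by (rule dvd_sum) (use qm [OF l] in auto)
          then have "int (q l) dvd (1 - m l * u l) - (\<Sum>i\<in>J - {l}. m i * u i)"
            using u [OF l] by (rule dvd_diff [rotated])
          then show "[1 = (\<Sum>i\<in>J. m i * u i)] (mod int (q l))"
            using J l by (simp add: cong_iff_dvd_diff sum.remove [of J l] algebra_simps)
        qed (use cop in auto)
        then have A: "of_int (1 - (\<Sum>i\<in>J. m i * u i)) * h \<in> K"
          by (intro Nmult) (simp add: cong_iff_dvd_diff)
        have B: "(\<Sum>i\<in>J. of_int (m i * u i) * (h - (\<Sum>j<d i. of_int (c i j) * e i j))) \<in> K"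
          using K
        proof (rule ring_ideal_sum)
          fix i
          assume i: "i \<in> J"
          obtain x a where x: "x \<in> K" "h - (\<Sum>j<d i. of_int (c i j) * e i j) = x + of_int (int (q i)) * a"
            using c [OF i] by (rule ideal_plusE)
          have "of_int (m i * u i) * (h - (\<Sum>j<d i. of_int (c i j) * e i j)) =
              of_int (m i * u i) * x + of_int (m i * int (q i)) * (of_int (u i) * a)"
            unfolding x(2) by (simp add: algebra_simps)
          also have "\<dots> \<in> K"
            using K x(1) mq [OF i] by (intro ring_ideal_add ring_ideal_mult Nmult) auto
          finally show "of_int (m i * u i) * (h - (\<Sum>j<d i. of_int (c i j) * e i j)) \<in> K" .
        qed
        have "of_int (1 - (\<Sum>i\<in>J. m i * u i)) * h +
            (\<Sum>i\<in>J. of_int (m i * u i) * (h - (\<Sum>j<d i. of_int (c i j) * e i j))) =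
            h - val (\<lambda>i j. u i * c i j)"
          by (simp add: val_def left_diff_distrib right_diff_distrib sum_subtractf
              sum_distrib_right sum_distrib_left mult.assoc)
        then have 1: "h - val (\<lambda>i j. u i * c i j) \<in> K"
          using ring_ideal_add [OF K A B] by simp
        define x where "x = (\<lambda>i\<in>J. \<lambda>j\<in>{..<d i}. (u i * c i j) mod int (q i))"
        have 2: "val (\<lambda>i j. u i * c i j) - val x \<in> K"
          by (rule val_cong) (simp add: x_def flip: mod_eq_dvd_iff)
        have "h - val x \<in> K"
          using ring_ideal_add [OF K 1 2] by simp
        then have "\<rho> h = \<rho> (val x)"
          by (simp add: \<rho>)
        moreover have "x \<in> carrier ?G"
          unfolding carr using q0 by (auto simp: x_def)
        ultimately show ?thesis
          by blast
      qed
      then show "(\<lambda>x. \<rho> (val x)) ` carrier ?G = carrier (add_monoid M)"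
        using \<rho>(1) by auto
    qed
  qed
  then have "?G \<cong> add_monoid M"
    by (rule is_isoI)
  then show ?thesis
    by (rule group.iso_sym [rotated]) (simp add: grp)
qed

section \<open>The involution\<close>

lift_definition bar :: "laurent \<Rightarrow> laurent" is "\<lambda>h e. h (- e)"
proof -
  fix h :: "int \<times> int \<Rightarrow> int"
  assume "finite {e. h e \<noteq> 0}"
  then have "finite (uminus ` {e. h e \<noteq> 0})"
    by simp
  then show "finite {e. h (- e) \<noteq> 0}"
    by (rule rev_finite_subset) (auto intro: image_eqI [of _ _ "- e" for e])
qed

lemma coef_bar [simp]: "coef (bar a) e = coef a (- e)"
  by (simp add: bar.rep_eq)

lemma bar_bar [simp]: "bar (bar a) = a"
  by (rule poly_mapping_eqI) simp

lemma bar_add [simp]: "bar (a + b) = bar a + bar b"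
  by (rule poly_mapping_eqI) (simp add: Poly_Mapping.lookup_add)

lemma bar_diff [simp]: "bar (a - b) = bar a - bar b"
  by (rule poly_mapping_eqI) (simp add: Poly_Mapping.lookup_minus)

lemma bar_of_int [simp]: "bar (of_int c) = of_int c"
proof -
  have "bar (of_int c * 1) = of_int c * 1"
    by (rule poly_mapping_eqI) (simp add: lookup_one when_def del: mult_1_right)
  then show ?thesis
    by simp
qed

lemma keys_bar: "Poly_Mapping.keys (bar a) = uminus ` Poly_Mapping.keys a"
  by (auto simp: in_keys_iff simp del: split_paired_All intro!: image_eqI [of _ uminus "- e" for e])

lemma bar_mult [simp]: "bar (a * b) = bar a * bar b"
proof (rule poly_mapping_eqI)
  fix e
  have "coef (bar a * bar b) e = (\<Sum>d\<in>uminus ` Poly_Mapping.keys a. coef a (- d) * coef b (- (e - d)))"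
    by (simp add: coef_mult keys_bar)
  also have "\<dots> = (\<Sum>d\<in>Poly_Mapping.keys a. coef a d * coef b (- e - d))"
  proof -
    have eq: "- (e - - d) = - e - d" for d :: "int \<times> int"
      by simp
    have "inj_on uminus (Poly_Mapping.keys a)"
      by simp
    then show ?thesis
      by (simp only: sum.reindex o_def minus_minus eq)
  qed
  finally show "coef (bar (a * b)) e = coef (bar a * bar b) e"
    by (simp add: coef_mult)
qed

lemma bar_zero [simp]: "bar 0 = 0"
  by (rule poly_mapping_eqI) simp

lemma bar_sum: "bar (sum h X) = (\<Sum>x\<in>X. bar (h x))"
  by (induction X rule: infinite_finite_induct) simp_all

lemma bar_in_mod_ideal_iff: "bar h \<in> mod_ideal m (bar F) (bar G) \<longleftrightarrow> h \<in> mod_ideal m F G"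
proof -
  have *: "bar h \<in> mod_ideal m (bar F) (bar G)" if "h \<in> mod_ideal m F G" for h F G
  proof -
    obtain a b c where "h = F * a + G * b + of_int m * c"
      using \<open>h \<in> mod_ideal m F G\<close> by (auto simp: mod_ideal_def)
    then have "bar h = bar F * bar a + bar G * bar b + of_int m * bar c"
      by simp
    then show ?thesis
      by (auto simp: mod_ideal_def)
  qed
  from * [of h F G] * [of "bar h" "bar F" "bar G"] show ?thesis
    by auto
qed

text \<open>The involution is a ring automorphism fixing the integers, so both summands of the anyon
  module have the same rank; this is the source of the factor 2.\<close>

lemma residue_basis_bar:
  assumes "residue_basis p (mod_ideal m F G) d e"
  shows "residue_basis p (mod_ideal m (bar F) (bar G)) d (bar \<circ> e)"
proof -
  have comb: "(\<Sum>j<d. of_int (c j) * (bar \<circ> e) j) = bar (\<Sum>j<d. of_int (c j) * e j)" for c :: "nat \<Rightarrow> int"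
    by (simp add: bar_sum)
  have "\<exists>c :: nat \<Rightarrow> int. h - (\<Sum>j<d. of_int (c j) * (bar \<circ> e) j) \<in> mod_ideal m (bar F) (bar G)" for h
  proof -
    obtain c :: "nat \<Rightarrow> int" where "bar h - (\<Sum>j<d. of_int (c j) * e j) \<in> mod_ideal m F G"
      using assms unfolding residue_basis_def by blast
    then have "bar (bar h - (\<Sum>j<d. of_int (c j) * e j)) \<in> mod_ideal m (bar F) (bar G)"
      by (simp only: bar_in_mod_ideal_iff)
    then show ?thesis
      unfolding comb by auto
  qed
  moreover have "\<forall>j<d. p dvd c j"
    if "(\<Sum>j<d. of_int (c j) * (bar \<circ> e) j) \<in> mod_ideal m (bar F) (bar G)" for c :: "nat \<Rightarrow> int"
    using that assms unfolding comb bar_in_mod_ideal_iff residue_basis_def by blast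
  ultimately show ?thesis
    unfolding residue_basis_def by blast
qed

section \<open>The rings and modules of the code\<close>

text \<open>The structures of the code are images of rings that exist as types, under maps
  satisfying the homomorphism equations. Here and in the next three lemmas, laws and operations are
  transferred along such a map.\<close>

lemma abelian_group_of_surj:
  fixes R (structure) and \<rho> :: "'a :: ab_group_add \<Rightarrow> 'b"
  assumes "carrier R = range \<rho>" "\<And>a b. \<rho> (a + b) = \<rho> a \<oplus> \<rho> b" "\<zero> = \<rho> 0"
  shows "abelian_group R"
proof (rule abelian_groupI)
  fix x assume "x \<in> carrier R"
  then obtain a where a: "x = \<rho> a"
    using assms(1) by blast
  show "\<exists>y\<in>carrier R. y \<oplus> x = \<zero>"
    by (rule bexI [of _ "\<rho> (- a)"]) (simp_all add: a assms flip: assms(2))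
qed (use assms(1) in \<open>auto simp: assms(3) ac_simps simp flip: assms(2)\<close>)

lemma cring_of_surj:
  fixes R (structure) and \<rho> :: "'a :: comm_ring_1 \<Rightarrow> 'b"
  assumes "carrier R = range \<rho>" "\<And>a b. \<rho> (a + b) = \<rho> a \<oplus> \<rho> b" "\<zero> = \<rho> 0"
    and "\<And>a b. \<rho> (a * b) = \<rho> a \<otimes> \<rho> b" "\<one> = \<rho> 1"
  shows "cring R"
proof (rule cringI)
  show "abelian_group R"
    using assms(1-3) by (rule abelian_group_of_surj)
  show "comm_monoid R"
    by (rule comm_monoidI) (use assms(1) in \<open>auto simp: assms(5) ac_simps simp flip: assms(4)\<close>)
qed (use assms(1) in \<open>auto simp: algebra_simps simp flip: assms(2,4)\<close>)

lemma finsum_of_surj: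
  fixes R (structure) and \<rho> :: "'a :: ab_group_add \<Rightarrow> 'b"
  assumes "carrier R = range \<rho>" "\<And>a b. \<rho> (a + b) = \<rho> a \<oplus> \<rho> b" "\<zero> = \<rho> 0"
  shows "(\<Oplus>x\<in>X. \<rho> (h x)) = \<rho> (sum h X)"
proof -
  interpret abelian_group R
    using assms by (rule abelian_group_of_surj)
  show ?thesis
    by (induction X rule: infinite_finite_induct) (simp_all add: assms Pi_iff)
qed

lemma uminus_of_surj:
  fixes R (structure) and \<rho> :: "'a :: ab_group_add \<Rightarrow> 'b"
  assumes "carrier R = range \<rho>" "\<And>a b. \<rho> (a + b) = \<rho> a \<oplus> \<rho> b" "\<zero> = \<rho> 0"
  shows "\<rho> (- a) = \<ominus> \<rho> a"
proof -
  interpret abelian_group R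
    using assms by (rule abelian_group_of_surj)
  show ?thesis
    by (rule minus_equality [symmetric]) (simp_all add: assms flip: assms(2))
qed

section \<open>The coefficient rings and Laurent rings as images of integer rings\<close>

lemma Zmod_simps:
  "carrier (Zmod N) = {0..int N - 1}" "x \<oplus>\<^bsub>Zmod N\<^esub> y = (x + y) mod int N"
  "x \<otimes>\<^bsub>Zmod N\<^esub> y = (x * y) mod int N" "\<zero>\<^bsub>Zmod N\<^esub> = 0" "\<one>\<^bsub>Zmod N\<^esub> = 1 mod int N"
  by (simp_all add: Zmod_def residue_ring_def)

lemma carrier_Zmod: "N > 0 \<Longrightarrow> carrier (Zmod N) = range (\<lambda>c. c mod int N)"
  by (auto simp: Zmod_simps intro: image_eqI [of x _ x for x])

lemma cring_Zmod: "N > 0 \<Longrightarrow> cring (Zmod N)"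
  by (rule cring_of_surj [of _ "\<lambda>c. c mod int N"]) (simp_all add: carrier_Zmod Zmod_simps(2-) mod_simps)

lemma field_Zmod:
  assumes "prime p"
  shows "field (Zmod p)"
proof -
  have "p > 1"
    using assms by (rule prime_gt_1_nat)
  then have "Zmod p = residue_ring (int p)"
    by (simp add: Zmod_def residue_ring_def)
  then show ?thesis
    using residues_prime.is_field [of p] assms by (simp add: residues_prime_def)
qed

lemma finsum_Zmod:
  assumes "N > 0"
  shows "(\<Oplus>\<^bsub>Zmod N\<^esub>x\<in>X. h x mod int N) = sum h X mod int N"
  by (rule finsum_of_surj [of _ "\<lambda>c. c mod int N"])
    (use assms in \<open>simp_all add: carrier_Zmod Zmod_simps(2-) mod_simps\<close>)

definition proj :: "nat \<Rightarrow> laurent \<Rightarrow> int \<times> int \<Rightarrow> int" where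
  "proj N a = (\<lambda>e. coef a e mod int N)"

lemma proj_eq_iff: "proj N a = proj N b \<longleftrightarrow> of_int (int N) dvd a - b"
  by (simp add: proj_def fun_eq_iff of_int_dvd_iff Poly_Mapping.lookup_minus mod_eq_dvd_iff
      del: of_int_of_nat_eq)

lemma bb_ring_simps:
  "x \<oplus>\<^bsub>bb_ring N\<^esub> y = (\<lambda>e. x e \<oplus>\<^bsub>Zmod N\<^esub> y e)"
  "x \<otimes>\<^bsub>bb_ring N\<^esub> y = (\<lambda>e. \<Oplus>\<^bsub>Zmod N\<^esub>d\<in>{d. x d \<noteq> \<zero>\<^bsub>Zmod N\<^esub>}. x d \<otimes>\<^bsub>Zmod N\<^esub> y (e - d))"
  "\<zero>\<^bsub>bb_ring N\<^esub> = (\<lambda>e. \<zero>\<^bsub>Zmod N\<^esub>)"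
  "\<one>\<^bsub>bb_ring N\<^esub> = (\<lambda>e. if e = (0, 0) then \<one>\<^bsub>Zmod N\<^esub> else \<zero>\<^bsub>Zmod N\<^esub>)"
  "c \<odot>\<^bsub>bb_ring N\<^esub> x = (\<lambda>e. c \<otimes>\<^bsub>Zmod N\<^esub> x e)"
  by (simp_all add: laurent2_def)

text \<open>Since the lift has literally the coefficients of \<open>f\<close>, reducing
  \<open>f\<close> modulo a prime factor of \<open>N\<close> amounts to applying \<open>proj\<close>
  for that prime to the same lift.\<close>

lemma lift_proj:
  assumes "f \<in> carrier (bb_ring N)"
  shows "f = proj N (Abs_poly_mapping f)" "coef (Abs_poly_mapping f) = f"
proof -
  have f: "f e mod int N = f e" for e
    using assms by (auto simp: laurent2_def Zmod_simps image_subset_iff simp del: split_paired_All)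
  have "finite {e. f e \<noteq> 0}"
    using assms by (simp add: laurent2_def Zmod_simps)
  then show "coef (Abs_poly_mapping f) = f"
    by simp
  then show "f = proj N (Abs_poly_mapping f)"
    by (simp add: proj_def f)
qed

lemma carrier_bb_ring:
  assumes "N > 0"
  shows "carrier (bb_ring N) = range (proj N)"
proof
  show "carrier (bb_ring N) \<subseteq> range (proj N)"
    using lift_proj(1) by blast
  show "range (proj N) \<subseteq> carrier (bb_ring N)"
  proof
    fix h
    assume "h \<in> range (proj N)"
    then obtain a where a: "h = proj N a"
      by blast
    have "finite {e. proj N a e \<noteq> 0}"
      by (rule finite_subset [OF _ finite_keys [of a]]) (auto simp: proj_def in_keys_iff)
    then show "h \<in> carrier (bb_ring N)"
      using assms by (auto simp: a laurent2_def Zmod_simps proj_def)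
  qed
qed

lemma proj_closed: "N > 0 \<Longrightarrow> proj N a \<in> carrier (bb_ring N)"
  by (simp add: carrier_bb_ring)

lemma proj_add: "proj N (a + b) = proj N a \<oplus>\<^bsub>bb_ring N\<^esub> proj N b"
  by (simp add: proj_def bb_ring_simps Zmod_simps Poly_Mapping.lookup_add mod_simps)

lemma proj_zero: "\<zero>\<^bsub>bb_ring N\<^esub> = proj N 0"
  by (simp add: proj_def bb_ring_simps Zmod_simps)

lemma proj_one: "\<one>\<^bsub>bb_ring N\<^esub> = proj N 1"
  by (auto simp: proj_def bb_ring_simps Zmod_simps lookup_one when_def fun_eq_iff zero_prod_def)

lemma proj_mult:
  assumes "N > 0"
  shows "proj N (a * b) = proj N a \<otimes>\<^bsub>bb_ring N\<^esub> proj N b"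
proof
  fix e
  \<comment> \<open>The product in \<open>bb_ring N\<close> runs over exponents with nonzero residue
    only; the remaining terms of the integer product are multiples of \<open>N\<close>.\<close>
  define D where "D = {d. proj N a d \<noteq> 0}"
  have D: "D \<subseteq> Poly_Mapping.keys a"
    by (auto simp: D_def proj_def in_keys_iff)
  have "int N dvd (\<Sum>d\<in>Poly_Mapping.keys a - D. coef a d * coef b (e - d))"
    by (rule dvd_sum) (auto simp: D_def proj_def)
  then have "proj N (a * b) e = (\<Sum>d\<in>D. coef a d * coef b (e - d)) mod int N"
    unfolding proj_def coef_mult sum.subset_diff [OF D finite_keys]
    by (simp add: mod_eq_dvd_iff)
  also have "\<dots> = (\<Oplus>\<^bsub>Zmod N\<^esub>d\<in>D. (coef a d * coef b (e - d)) mod int N)"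
    by (rule finsum_Zmod [OF assms, symmetric])
  finally show "proj N (a * b) e = (proj N a \<otimes>\<^bsub>bb_ring N\<^esub> proj N b) e"
    by (simp add: bb_ring_simps Zmod_simps D_def proj_def mod_simps)
qed

lemma proj_smult: "c \<odot>\<^bsub>bb_ring N\<^esub> proj N a = proj N (of_int c * a)"
  by (simp add: bb_ring_simps Zmod_simps proj_def mod_simps)

lemma cring_bb_ring: "N > 0 \<Longrightarrow> cring (bb_ring N)"
  by (rule cring_of_surj [of _ "proj N"])
    (simp_all add: carrier_bb_ring proj_add proj_zero proj_one proj_mult)

lemma proj_uminus: "N > 0 \<Longrightarrow> \<ominus>\<^bsub>bb_ring N\<^esub> proj N a = proj N (- a)"
  by (rule uminus_of_surj [of _ "proj N", symmetric]) (simp_all add: carrier_bb_ring proj_add proj_zero)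

lemma finsum_proj: "N > 0 \<Longrightarrow> (\<Oplus>\<^bsub>bb_ring N\<^esub>x\<in>X. proj N (h x)) = proj N (sum h X)"
  by (rule finsum_of_surj) (simp_all add: carrier_bb_ring proj_add proj_zero)

lemma laurent_bar_proj: "laurent_bar (proj N a) = proj N (bar a)"
  by (auto simp: laurent_bar_def proj_def)

section \<open>Vectors, matrices and the maps of the code complex\<close>

definition vec :: "nat \<Rightarrow> nat \<Rightarrow> (nat \<Rightarrow> laurent) \<Rightarrow> nat \<Rightarrow> int \<times> int \<Rightarrow> int" where
  "vec N l a = (\<lambda>i\<in>{..<l}. proj N (a i))"

lemma vec_eq_iff: "vec N l a = vec N l b \<longleftrightarrow> (\<forall>i<l. of_int (int N) dvd a i - b i)"
proof
  assume eq: "vec N l a = vec N l b"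
  show "\<forall>i<l. of_int (int N) dvd a i - b i"
    unfolding proj_eq_iff [symmetric]
  proof (intro allI impI)
    show "proj N (a i) = proj N (b i)" if "i < l" for i
      using fun_cong [OF eq, of i] that by (simp add: vec_def)
  qed
next
  assume "\<forall>i<l. of_int (int N) dvd a i - b i"
  then show "vec N l a = vec N l b"
    unfolding vec_def proj_eq_iff [symmetric] by (intro restrict_ext) simp
qed

lemma vec_cong: "(\<And>i. i < l \<Longrightarrow> a i = b i) \<Longrightarrow> vec N l a = vec N l b"
  by (simp add: vec_eq_iff)

lemma free_module_simps:
  assumes "N > 0"
  shows "carrier (free_module (bb_ring N) l) = range (vec N l)"
    and "vec N l (a + b) = vec N l a \<oplus>\<^bsub>free_module (bb_ring N) l\<^esub> vec N l b"
    and "\<zero>\<^bsub>free_module (bb_ring N) l\<^esub> = vec N l 0"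
    and "proj N t \<odot>\<^bsub>free_module (bb_ring N) l\<^esub> vec N l a = vec N l ((\<lambda>_. t) * a)"
proof -
  interpret cring "bb_ring N"
    by (rule cring_bb_ring [OF assms])
  show "carrier (free_module (bb_ring N) l) = range (vec N l)"
  proof
    show "carrier (free_module (bb_ring N) l) \<subseteq> range (vec N l)"
    proof
      fix v
      assume "v \<in> carrier (free_module (bb_ring N) l)"
      then have v: "v \<in> {..<l} \<rightarrow>\<^sub>E range (proj N)"
        by (simp add: func_space_def carrier_bb_ring assms)
      then have "\<forall>i. \<exists>a. i < l \<longrightarrow> v i = proj N a"
        by (force simp: PiE_iff)
      then obtain a where "\<And>i. i < l \<Longrightarrow> v i = proj N (a i)"
        by metis
      then have "v = vec N l a"
        using v by (auto simp: vec_def PiE_iff extensional_def fun_eq_iff)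
      then show "v \<in> range (vec N l)"
        by blast
    qed
  qed (auto simp: func_space_def carrier_bb_ring assms vec_def)
  show "vec N l (a + b) = vec N l a \<oplus>\<^bsub>free_module (bb_ring N) l\<^esub> vec N l b"
    by (simp add: func_space_def vec_def proj_add restrict_def fun_eq_iff)
  show "\<zero>\<^bsub>free_module (bb_ring N) l\<^esub> = vec N l 0"
    by (simp add: func_space_def vec_def proj_zero)
  show "proj N t \<odot>\<^bsub>free_module (bb_ring N) l\<^esub> vec N l a = vec N l ((\<lambda>_. t) * a)"
    by (simp add: func_space_def vec_def proj_mult assms restrict_def fun_eq_iff)
qed

lemma mat_apply_vec:
  assumes "N > 0" and rows: "\<And>row. row \<in> set A \<Longrightarrow> length row = l"
  shows "mat_apply (bb_ring N) (map (map (proj N)) A) (vec N l a) =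
    vec N (length A) (\<lambda>i. \<Sum>j<l. A ! i ! j * a j)"
proof -
  have "(\<Oplus>\<^bsub>bb_ring N\<^esub>j\<in>{..<l}. map (proj N) (A ! i) ! j \<otimes>\<^bsub>bb_ring N\<^esub> vec N l a j) =
      proj N (\<Sum>j<l. A ! i ! j * a j)" if "i < length A" for i
  proof -
    interpret cring "bb_ring N"
      by (rule cring_bb_ring [OF assms(1)])
    have "(\<Oplus>\<^bsub>bb_ring N\<^esub>j\<in>{..<l}. map (proj N) (A ! i) ! j \<otimes>\<^bsub>bb_ring N\<^esub> vec N l a j) =
        (\<Oplus>\<^bsub>bb_ring N\<^esub>j\<in>{..<l}. proj N (A ! i ! j * a j))"
      by (rule finsum_cong')
        (use rows [OF nth_mem [OF that]] in \<open>auto simp: vec_def proj_mult [OF assms(1)] proj_closed [OF assms(1)]\<close>)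
    also have "\<dots> = proj N (\<Sum>j<l. A ! i ! j * a j)"
      by (rule finsum_proj [OF assms(1)])
    finally show ?thesis .
  qed
  then show ?thesis
    by (auto simp: mat_apply_def vec_def rows restrict_def fun_eq_iff)
qed

lemma syndrome_vec:
  assumes "N > 0"
  shows "bb_syndrome N (proj N F) (proj N G) (vec N 4 a) =
    vec N 2 (\<lambda>i. if i = 0 then F * a 2 + G * a 3 else bar F * a 1 - bar G * a 0)"
proof -
  let ?A = "[[0, 0, F, G], [- bar G, bar F, 0, 0]]"
  have eq: "bb_syndrome N (proj N F) (proj N G) = mat_apply (bb_ring N) (map (map (proj N)) ?A)"
    unfolding bb_syndrome_def proj_zero laurent_bar_proj proj_uminus [OF assms] list.map by (rule refl)
  have "bb_syndrome N (proj N F) (proj N G) (vec N 4 a) = vec N (length ?A) (\<lambda>i. \<Sum>j<4. ?A ! i ! j * a j)"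
    unfolding eq by (rule mat_apply_vec [OF assms]) auto
  also have "length ?A = 2"
    by simp
  also have "vec N 2 (\<lambda>i. \<Sum>j<4. ?A ! i ! j * a j) =
      vec N 2 (\<lambda>i. if i = 0 then F * a 2 + G * a 3 else bar F * a 1 - bar G * a 0)"
  proof (rule vec_cong)
    fix i :: nat
    assume "i < 2"
    then consider "i = 0" | "i = 1"
      by linarith
    moreover have "{..<4 :: nat} = {0, 1, 2, 3}"
      by auto
    ultimately show "(\<Sum>j<4. ?A ! i ! j * a j) =
        (if i = 0 then F * a 2 + G * a 3 else bar F * a 1 - bar G * a 0)"
      by cases simp_all
  qed
  finally show ?thesis .
qed

lemma boundary_vec:
  assumes "N > 0"
  shows "bb_boundary N (proj N F) (proj N G) (vec N 2 a) = vec N 4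
    (\<lambda>i. if i = 0 then bar F * a 0 else if i = 1 then bar G * a 0 else if i = 2 then G * a 1 else - F * a 1)"
proof -
  let ?A = "[[bar F, 0], [bar G, 0], [0, G], [0, - F]]"
  have eq: "bb_boundary N (proj N F) (proj N G) = mat_apply (bb_ring N) (map (map (proj N)) ?A)"
    unfolding bb_boundary_def proj_zero laurent_bar_proj proj_uminus [OF assms] list.map by (rule refl)
  have "bb_boundary N (proj N F) (proj N G) (vec N 2 a) = vec N (length ?A) (\<lambda>i. \<Sum>j<2. ?A ! i ! j * a j)"
    unfolding eq by (rule mat_apply_vec [OF assms]) auto
  also have "length ?A = 4"
    by simp
  also have "vec N 4 (\<lambda>i. \<Sum>j<2. ?A ! i ! j * a j) =
      vec N 4 (\<lambda>i. if i = 0 then bar F * a 0 else if i = 1 then bar G * a 0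
        else if i = 2 then G * a 1 else - F * a 1)"
  proof (rule vec_cong)
    fix i :: nat
    assume "i < 4"
    then consider "i = 0" | "i = 1" | "i = 2" | "i = 3"
      by linarith
    moreover have "{..<2 :: nat} = {0, 1}"
      by auto
    ultimately show "(\<Sum>j<2. ?A ! i ! j * a j) = (if i = 0 then bar F * a 0 else if i = 1 then bar G * a 0
        else if i = 2 then G * a 1 else - F * a 1)"
      by cases simp_all
  qed
  finally show ?thesis .
qed

lemma koszul_exact_of_topological:
  assumes N: "N > 0" and top: "bb_topological N (proj N F) (proj N G)"
  shows "koszul_exact (int N) F G"
  unfolding koszul_exact_def
proof (intro allI impI)
  fix a b
  assume ab: "of_int (int N) dvd F * a + G * b"
  \<comment> \<open>On the last two coordinates the complex is the Koszul complex itself: the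
    syndrome of \<open>(0, 0, a, b)\<close> is \<open>F a + G b\<close>, and the second column of
    the boundary is \<open>(G, - F)\<close>.\<close>
  define c :: "nat \<Rightarrow> laurent" where "c i = (if i = 2 then a else if i = 3 then b else 0)" for i
  have "bb_syndrome N (proj N F) (proj N G) (vec N 4 c) = vec N 2 0"
    unfolding syndrome_vec [OF N] vec_eq_iff using ab by (auto simp: c_def less_Suc_eq numeral_eq_Suc)
  then have "vec N 4 c \<in> bb_boundary N (proj N F) (proj N G) ` range (vec N 2)"
    using top unfolding bb_topological_def free_module_simps [OF N] by blast
  then obtain w where "vec N 4 c = bb_boundary N (proj N F) (proj N G) (vec N 2 w)"
    by blast
  then have *: "\<forall>i<4. of_int (int N) dvd c i - (if i = 0 then bar F * w 0 else if i = 1 then bar G * w 0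
      else if i = 2 then G * w 1 else - F * w 1)"
    unfolding boundary_vec [OF N] vec_eq_iff .
  have "of_int (int N) dvd a - G * w 1" "of_int (int N) dvd b + F * w 1"
    using *[rule_format, of 2] *[rule_format, of 3] by (simp_all add: c_def)
  then show "\<exists>r. of_int (int N) dvd a - G * r \<and> of_int (int N) dvd b + F * r"
    by blast
qed

section \<open>Quotient modules and their dimension\<close>

lemma a_r_coset_of_surj:
  fixes M (structure)
  assumes "\<And>a b. \<rho> (a + b) = \<rho> a \<oplus> \<rho> b"
  shows "(\<rho> ` K) +> \<rho> a = \<rho> ` ((\<lambda>x. x + a) ` K)"
  by (auto simp: a_r_coset_def r_coset_def simp flip: assms)

text \<open>By \<open>ker\<close> the ideal \<open>K\<close> is the full preimage of its image under
  \<open>\<rho>\<close>, so equality of cosets can be tested upstairs as membership of a difference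
  in \<open>K\<close>.\<close>

lemma quot_module_of_surj:
  fixes M :: "('a, 'b, 'm) module_scheme" (structure) and \<rho> :: "'c :: comm_ring_1 \<Rightarrow> 'b"
  assumes \<rho>: "carrier M = range \<rho>" "\<And>a b. \<rho> (a + b) = \<rho> a \<oplus> \<rho> b"
    and K: "ring_ideal K" and ker: "\<forall>a b. \<rho> a = \<rho> b \<longrightarrow> a - b \<in> K"
  defines "\<sigma> \<equiv> \<lambda>a. (\<rho> ` K) +> \<rho> a"
  shows "carrier (quot_module M (\<rho> ` K)) = range \<sigma>"
    and "\<sigma> (a + b) = \<sigma> a \<oplus>\<^bsub>quot_module M (\<rho> ` K)\<^esub> \<sigma> b"
    and "\<zero>\<^bsub>quot_module M (\<rho> ` K)\<^esub> = \<sigma> 0"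
    and "\<sigma> a = \<sigma> b \<longleftrightarrow> a - b \<in> K"
    and "(\<And>a. r \<odot> \<rho> a = \<rho> (t * a)) \<Longrightarrow> r \<odot>\<^bsub>quot_module M (\<rho> ` K)\<^esub> \<sigma> a = \<sigma> (t * a)"
proof -
  have \<sigma>: "\<sigma> a = \<rho> ` ((\<lambda>x. x + a) ` K)" for a
    unfolding \<sigma>_def by (rule a_r_coset_of_surj [OF \<rho>(2)])
  have \<sigma>_iff: "\<sigma> a = \<sigma> b \<longleftrightarrow> a - b \<in> K" for a b
  proof
    assume "\<sigma> a = \<sigma> b"
    moreover have "\<rho> (0 + a) \<in> \<sigma> a"
      unfolding \<sigma> using K by (blast intro: ring_ideal_zero)
    ultimately obtain x where "x \<in> K" "\<rho> (0 + a) = \<rho> (x + b)"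
      unfolding \<sigma> by blast
    then have "a - (x + b) \<in> K" "x \<in> K"
      using ker by simp_all
    then have "a - (x + b) + x \<in> K"
      using K by (blast intro: ring_ideal_add)
    then show "a - b \<in> K"
      by (simp add: algebra_simps)
  next
    have sub: "\<sigma> a \<subseteq> \<sigma> b" if "a - b \<in> K" for a b
    proof
      fix y
      assume "y \<in> \<sigma> a"
      then obtain x where x: "x \<in> K" "y = \<rho> (x + a)"
        unfolding \<sigma> by blast
      have "y = \<rho> ((x + (a - b)) + b)"
        by (simp add: x)
      moreover have "x + (a - b) \<in> K"
        using K x(1) \<open>a - b \<in> K\<close> by (rule ring_ideal_add)
      ultimately show "y \<in> \<sigma> b"
        unfolding \<sigma> by blast
    qed
    assume "a - b \<in> K"
    moreover have "b - a \<in> K"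
      using ring_ideal_uminus [OF K \<open>a - b \<in> K\<close>] by simp
    ultimately show "\<sigma> a = \<sigma> b"
      using sub by blast
  qed
  then show "\<sigma> a = \<sigma> b \<longleftrightarrow> a - b \<in> K" .
  show "carrier (quot_module M (\<rho> ` K)) = range \<sigma>"
    by (auto simp: quot_module_def A_RCOSETS_def RCOSETS_def \<rho>(1) \<sigma>_def a_r_coset_def)
  show "\<sigma> (a + b) = \<sigma> a \<oplus>\<^bsub>quot_module M (\<rho> ` K)\<^esub> \<sigma> b"
  proof -
    have "\<sigma> a <+>\<^bsub>M\<^esub> \<sigma> b = \<sigma> (a + b)"
    proof (intro subset_antisym subsetI)
      fix y
      assume "y \<in> \<sigma> a <+>\<^bsub>M\<^esub> \<sigma> b"
      then obtain x x' where x: "x \<in> K" "x' \<in> K" "y = \<rho> (x + a) \<oplus> \<rho> (x' + b)"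
        unfolding \<sigma> set_add_def set_mult_def by auto
      have "y = \<rho> ((x + x') + (a + b))"
        unfolding x(3) \<rho>(2) [symmetric] by (simp add: ac_simps)
      moreover have "x + x' \<in> K"
        using K x by (blast intro: ring_ideal_add)
      ultimately show "y \<in> \<sigma> (a + b)"
        unfolding \<sigma> by blast
    next
      fix y
      assume "y \<in> \<sigma> (a + b)"
      then obtain x where x: "x \<in> K" "y = \<rho> (x + (a + b))"
        unfolding \<sigma> by blast
      have "y = \<rho> (x + a) \<oplus> \<rho> (0 + b)"
        unfolding x(2) \<rho>(2) [symmetric] by (simp add: ac_simps)
      moreover have "\<rho> (x + a) \<in> \<sigma> a" "\<rho> (0 + b) \<in> \<sigma> b"
        unfolding \<sigma> using x(1) ring_ideal_zero [OF K] by blast+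
      ultimately show "y \<in> \<sigma> a <+>\<^bsub>M\<^esub> \<sigma> b"
        unfolding set_add_def set_mult_def by auto
    qed
    then show ?thesis
      by (simp add: quot_module_def)
  qed
  show "\<zero>\<^bsub>quot_module M (\<rho> ` K)\<^esub> = \<sigma> 0"
    by (simp add: quot_module_def \<sigma> image_image)
  show "r \<odot>\<^bsub>quot_module M (\<rho> ` K)\<^esub> \<sigma> a = \<sigma> (t * a)" if r: "\<And>a. r \<odot> \<rho> a = \<rho> (t * a)"
  proof -
    \<comment> \<open>The scalar action is a union of cosets over all representatives; they all
      coincide because \<open>K\<close> absorbs multiplication by \<open>t\<close>.\<close>
    have "(\<Union>v\<in>\<sigma> a. (\<rho> ` K) +> (r \<odot> v)) = (\<Union>x\<in>K. \<sigma> (t * (x + a)))"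
      unfolding \<sigma> [of a] by (simp add: image_image r \<sigma>_def)
    also have "\<dots> = (\<Union>x\<in>K. \<sigma> (t * a))"
    proof (rule SUP_cong)
      fix x
      assume "x \<in> K"
      then have "t * (x + a) - t * a \<in> K"
        using ring_ideal_mult [OF K, of x t] by (simp add: distrib_left)
      then show "\<sigma> (t * (x + a)) = \<sigma> (t * a)"
        by (simp add: \<sigma>_iff)
    qed simp
    also have "\<dots> = \<sigma> (t * a)"
      using ring_ideal_zero [OF K] by blast
    finally show ?thesis
      by (simp add: quot_module_def)
  qed
qed

lemma vectorspace_dim_residue_basis:
  fixes V :: "(int, 'b, 'm) module_scheme" and \<sigma> :: "'a :: comm_ring_1 \<Rightarrow> 'b"
  assumes p: "prime p"
    and \<sigma>: "carrier V = range \<sigma>" "\<And>a b. \<sigma> (a + b) = \<sigma> a \<oplus>\<^bsub>V\<^esub> \<sigma> b" "\<zero>\<^bsub>V\<^esub> = \<sigma> 0"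
      "\<And>a b. \<sigma> a = \<sigma> b \<longleftrightarrow> a - b \<in> K"
      "\<And>c a. c \<in> carrier (Zmod p) \<Longrightarrow> c \<odot>\<^bsub>V\<^esub> \<sigma> a = \<sigma> (of_int c * a)"
    and K: "ring_ideal K" "of_int (int p) \<in> K"
    and basis: "residue_basis (int p) K d e"
  shows "vectorspace.fin_dim (Zmod p) V \<and> vectorspace.dim (Zmod p) V = d"
proof -
  have p1: "int p > 1"
    using prime_gt_1_nat [OF p] by simp
  have p0: "p > 0"
    using p1 by simp
  \<comment> \<open>Sums and products of scalars are reduced modulo \<open>p\<close>; the action
    does not see this because \<open>p\<close> lies in \<open>K\<close>.\<close>
  have mod_mult: "\<sigma> (of_int (c mod int p) * a) = \<sigma> (of_int c * a)" for c a
  proof -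
    have "int p dvd c mod int p - c"
      by (simp flip: mod_eq_dvd_iff)
    then have "of_int (int p) dvd (of_int (c mod int p - c) * a)"
      by (intro dvd_mult2 of_int_dvd_of_int)
    then have "of_int (c mod int p - c) * a \<in> K"
      by (rule ring_ideal_dvd [OF K])
    then show ?thesis
      by (simp add: \<sigma>(4) algebra_simps)
  qed
  have one: "\<one>\<^bsub>Zmod p\<^esub> = 1"
    using p1 by (simp add: Zmod_simps)
  interpret field "Zmod p"
    by (rule field_Zmod [OF p])
  interpret vs: vectorspace "Zmod p" V
    unfolding vectorspace_def
  proof
    show "Module.module (Zmod p) V"
    proof (rule moduleI)
      show "cring (Zmod p)"
        by (rule cring_Zmod [OF p0])
      show "abelian_group V"
        by (rule abelian_group_of_surj [OF \<sigma>(1-3)])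
      show "c \<odot>\<^bsub>V\<^esub> v \<in> carrier V" if "c \<in> carrier (Zmod p)" "v \<in> carrier V" for c v
        using that by (auto simp: \<sigma>(1) \<sigma>(5))
      show "(a \<oplus>\<^bsub>Zmod p\<^esub> b) \<odot>\<^bsub>V\<^esub> v = a \<odot>\<^bsub>V\<^esub> v \<oplus>\<^bsub>V\<^esub> b \<odot>\<^bsub>V\<^esub> v"
        if ab: "a \<in> carrier (Zmod p)" "b \<in> carrier (Zmod p)" and "v \<in> carrier V" for a b v
      proof -
        obtain h where h: "v = \<sigma> h"
          using \<open>v \<in> carrier V\<close> \<sigma>(1) by blast
        have "a \<oplus>\<^bsub>Zmod p\<^esub> b \<in> carrier (Zmod p)"
          using ab by simp
        then have "(a \<oplus>\<^bsub>Zmod p\<^esub> b) \<odot>\<^bsub>V\<^esub> v = \<sigma> (of_int (a \<oplus>\<^bsub>Zmod p\<^esub> b) * h)"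
          unfolding h by (rule \<sigma>(5))
        also have "\<dots> = \<sigma> (of_int (a + b) * h)"
          unfolding Zmod_simps by (rule mod_mult)
        finally show ?thesis
          using ab by (simp add: h \<sigma>(5) distrib_right flip: \<sigma>(2))
      qed
      show "a \<odot>\<^bsub>V\<^esub> (v \<oplus>\<^bsub>V\<^esub> w) = a \<odot>\<^bsub>V\<^esub> v \<oplus>\<^bsub>V\<^esub> a \<odot>\<^bsub>V\<^esub> w"
        if "a \<in> carrier (Zmod p)" "v \<in> carrier V" "w \<in> carrier V" for a v w
        using that by (auto simp: \<sigma>(1) \<sigma>(5) algebra_simps simp flip: \<sigma>(2))
      show "(a \<otimes>\<^bsub>Zmod p\<^esub> b) \<odot>\<^bsub>V\<^esub> v = a \<odot>\<^bsub>V\<^esub> (b \<odot>\<^bsub>V\<^esub> v)"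
        if ab: "a \<in> carrier (Zmod p)" "b \<in> carrier (Zmod p)" and "v \<in> carrier V" for a b v
      proof -
        obtain h where h: "v = \<sigma> h"
          using \<open>v \<in> carrier V\<close> \<sigma>(1) by blast
        have "a \<otimes>\<^bsub>Zmod p\<^esub> b \<in> carrier (Zmod p)"
          using ab by simp
        then have "(a \<otimes>\<^bsub>Zmod p\<^esub> b) \<odot>\<^bsub>V\<^esub> v = \<sigma> (of_int (a \<otimes>\<^bsub>Zmod p\<^esub> b) * h)"
          unfolding h by (rule \<sigma>(5))
        also have "\<dots> = \<sigma> (of_int (a * b) * h)"
          unfolding Zmod_simps by (rule mod_mult)
        finally show ?thesis
          using ab by (simp add: h \<sigma>(5) mult.assoc)
      qed
      show "\<one>\<^bsub>Zmod p\<^esub> \<odot>\<^bsub>V\<^esub> v = v" if "v \<in> carrier V" for v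
        using that one_closed by (auto simp: \<sigma>(1) \<sigma>(5) one)
    qed
  qed (rule field_Zmod [OF p])
  define A where "A = (\<sigma> \<circ> e) ` {..<d}"
  have A: "finite A" "A \<subseteq> carrier V"
    by (auto simp: A_def \<sigma>(1))
  have inj: "inj_on (\<sigma> \<circ> e) {..<d}"
  proof (rule inj_onI, rule ccontr)
    fix i j
    assume ij: "i \<in> {..<d}" "j \<in> {..<d}" "(\<sigma> \<circ> e) i = (\<sigma> \<circ> e) j" "i \<noteq> j"
    \<comment> \<open>If two basis elements had the same class, their difference would be a relation
      with coefficients 1 and -1, which are not divisible by \<open>p\<close>. Distinctness is what
      gives \<open>A\<close> exactly \<open>d\<close> elements.\<close>
    define c :: "nat \<Rightarrow> int" where "c l = (if l = i then 1 else if l = j then - 1 else 0)" for l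
    have "(\<Sum>l<d. of_int (c l) * e l) = (\<Sum>l\<in>{i, j}. of_int (c l) * e l)"
      by (rule sum.mono_neutral_right) (use ij in \<open>auto simp: c_def\<close>)
    also have "\<dots> = e i - e j"
      using ij by (simp add: c_def)
    also have "\<dots> \<in> K"
      using ij by (simp add: \<sigma>(4))
    finally have "int p dvd c i"
      using ij(1) by (intro residue_basis_indep [OF basis]) auto
    then show False
      using p1 by (simp add: c_def)
  qed
  have lincomb: "vs.lincomb a A = \<sigma> (\<Sum>j<d. of_int (a (\<sigma> (e j))) * e j)"
    if a: "a \<in> A \<rightarrow> carrier (Zmod p)" for a
  proof -
    have "vs.lincomb a A = (\<Oplus>\<^bsub>V\<^esub>j\<in>{..<d}. a ((\<sigma> \<circ> e) j) \<odot>\<^bsub>V\<^esub> (\<sigma> \<circ> e) j)"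
      unfolding vs.lincomb_def A_def
      by (rule vs.M.finsum_reindex [OF _ inj]) (use a A in \<open>auto simp: A_def\<close>)
    also have "\<dots> = (\<Oplus>\<^bsub>V\<^esub>j\<in>{..<d}. \<sigma> (of_int (a (\<sigma> (e j))) * e j))"
      by (rule vs.M.finsum_cong') (use a in \<open>auto simp: A_def \<sigma>(1) intro!: \<sigma>(5)\<close>)
    also have "\<dots> = \<sigma> (\<Sum>j<d. of_int (a (\<sigma> (e j))) * e j)"
      by (rule finsum_of_surj [OF \<sigma>(1-3)])
    finally show ?thesis .
  qed
  have "vs.lin_indpt A"
  proof (rule vs.finite_lin_indpt2 [OF A])
    fix a
    assume a: "a \<in> A \<rightarrow> carrier (Zmod p)" and "vs.lincomb a A = \<zero>\<^bsub>V\<^esub>"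
    then have "(\<Sum>j<d. of_int (a (\<sigma> (e j))) * e j) \<in> K"
      by (simp add: lincomb \<sigma>(3,4))
    then have "\<forall>j<d. int p dvd a (\<sigma> (e j))"
      by (intro allI impI) (rule residue_basis_indep [OF basis, of "\<lambda>j. a (\<sigma> (e j))"])
    moreover have "a (\<sigma> (e j)) \<in> {0..int p - 1}" if "j < d" for j
      using a that unfolding A_def Zmod_simps by auto
    ultimately show "\<forall>v\<in>A. a v = \<zero>\<^bsub>Zmod p\<^esub>"
      by (auto simp: A_def Zmod_simps dest!: zdvd_imp_le) (metis atLeastAtMost_iff le_less not_le zdvd_not_zless zle_diff1_eq)
  qed
  moreover have gen: "vs.gen_set A"
  proof
    show "vs.span A \<subseteq> carrier V"
      by (rule vs.span_is_subset2 [OF A(2)])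
    show "carrier V \<subseteq> vs.span A"
    proof
      fix v
      assume "v \<in> carrier V"
      then obtain h where h: "v = \<sigma> h"
        using \<sigma>(1) by blast
      obtain c :: "nat \<Rightarrow> int" where c: "h - (\<Sum>j<d. of_int (c j) * e j) \<in> K"
        using residue_basis_span [OF basis] by blast
      define a where "a v = c (the_inv_into {..<d} (\<sigma> \<circ> e) v) mod int p" for v
      have a: "a \<in> A \<rightarrow> carrier (Zmod p)"
        using p1 by (auto simp: a_def Zmod_simps)
      have "a (\<sigma> (e j)) = c j mod int p" if "j < d" for j
        using the_inv_into_f_f [OF inj, of j] that by (simp add: a_def)
      then have "(\<Sum>j<d. of_int (c j) * e j) - (\<Sum>j<d. of_int (a (\<sigma> (e j))) * e j) =
          (\<Sum>j<d. of_int (c j - c j mod int p) * e j)"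
        by (simp add: sum_subtractf left_diff_distrib)
      also have "\<dots> \<in> K"
        by (intro ring_ideal_sum K ring_ideal_dvd [OF K] dvd_mult2 of_int_dvd_of_int) simp
      finally have "h - (\<Sum>j<d. of_int (a (\<sigma> (e j))) * e j) \<in> K"
        by (rule ring_ideal_diff_trans [OF K(1) c])
      then have "v = vs.lincomb a A"
        by (simp add: h lincomb a \<sigma>(4))
      then show "v \<in> vs.span A"
        using A a unfolding vs.span_def by blast
    qed
  qed
  ultimately have "vs.basis A"
    using A by (simp add: vs.basis_def)
  then have "vs.dim = card A"
    using A by (intro vs.dim_basis)
  then have "vs.dim = d"
    using card_image [OF inj] by (simp add: A_def)
  moreover have "vs.fin_dim"
    unfolding vs.fin_dim_def using A gen by blast
  ultimately show "vs.fin_dim \<and> vs.dim = d"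
    by blast
qed

section \<open>The anyon module\<close>

lemma of_int_fun_apply: "(of_int c :: 'x \<Rightarrow> 'a :: ring_1) i = of_int c"
proof -
  obtain m n where "c = int m - int n"
    by (rule int_diff_cases)
  then show ?thesis
    by simp
qed

lemma sum_fun_apply: "(sum h X :: 'x \<Rightarrow> 'a :: comm_monoid_add) i = (\<Sum>x\<in>X. h x i)"
  by (induction X rule: infinite_finite_induct) simp_all

text \<open>
  Pairs of Laurent polynomials are encoded as functions on \<open>nat\<close>, of which only the values at
  \<open>0\<close> and \<open>1\<close> matter; this makes them a ring with pointwise operations.
\<close>

definition pair_ideal :: "int \<Rightarrow> laurent \<Rightarrow> laurent \<Rightarrow> (nat \<Rightarrow> laurent) set" where
  "pair_ideal m F G = {a. a 0 \<in> mod_ideal m F G \<and> a 1 \<in> mod_ideal m (bar F) (bar G)}"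

lemma ring_ideal_pair_ideal: "ring_ideal (pair_ideal m F G)"
  using ring_ideal_mod_ideal [of m F G] ring_ideal_mod_ideal [of m "bar F" "bar G"]
  by (auto simp: ring_ideal_def pair_ideal_def)

lemma of_int_in_pair_ideal: "of_int m \<in> pair_ideal m F G"
  by (simp add: pair_ideal_def of_int_fun_apply mod_ideal_generators)

lemma mod_ideal_plus_iff:
  assumes "m dvd n"
  shows "a \<in> mod_ideal m F G \<longleftrightarrow> (\<exists>x\<in>mod_ideal n F G. \<exists>c. a = x + of_int m * c)"
proof
  assume "a \<in> mod_ideal m F G"
  then obtain x y z where "a = (F * x + G * y + of_int n * 0) + of_int m * z"
    by (auto simp: mod_ideal_def)
  then show "\<exists>x\<in>mod_ideal n F G. \<exists>c. a = x + of_int m * c"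
    unfolding mod_ideal_def by blast
next
  assume "\<exists>x\<in>mod_ideal n F G. \<exists>c. a = x + of_int m * c"
  then obtain u v w c where "a = F * u + G * v + of_int n * w + of_int m * c"
    by (auto simp: mod_ideal_def)
  moreover obtain n' where "n = m * n'"
    using assms by (rule dvdE)
  ultimately have "a = F * u + G * v + of_int m * (of_int n' * w + c)"
    by (simp add: algebra_simps)
  then show "a \<in> mod_ideal m F G"
    unfolding mod_ideal_def by blast
qed

lemma ideal_plus_pair_ideal:
  assumes "m dvd n"
  shows "ideal_plus (pair_ideal n F G) m = pair_ideal m F G"
proof (intro subset_antisym subsetI)
  fix a
  assume "a \<in> ideal_plus (pair_ideal n F G) m"
  then obtain x c where "x \<in> pair_ideal n F G" "a = x + of_int m * c"
    by (rule ideal_plusE)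
  then show "a \<in> pair_ideal m F G"
    by (auto simp: pair_ideal_def of_int_fun_apply mod_ideal_plus_iff [OF assms])
next
  fix a
  assume "a \<in> pair_ideal m F G"
  then obtain x c y d where x: "x \<in> mod_ideal n F G" "a 0 = x + of_int m * c"
      "y \<in> mod_ideal n (bar F) (bar G)" "a 1 = y + of_int m * d"
    unfolding pair_ideal_def mod_ideal_plus_iff [OF assms] by blast
  \<comment> \<open>Coordinates other than 0 and 1 are unconstrained in \<open>pair_ideal\<close>,
    so \<open>u\<close> copies \<open>a\<close> there.\<close>
  define u where "u i = (if i = 0 then x else if i = 1 then y else a i)" for i :: nat
  define v where "v i = (if i = 0 then c else if i = 1 then d else 0)" for i :: nat
  have "u \<in> pair_ideal n F G"
    by (simp add: pair_ideal_def u_def x)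
  moreover have "a = u + of_int m * v"
    using x by (auto simp: fun_eq_iff u_def v_def of_int_fun_apply)
  ultimately show "a \<in> ideal_plus (pair_ideal n F G) m"
    by (rule ideal_plusI)
qed

text \<open>The first \<open>d\<close> vectors carry the basis of the first summand in coordinate 0,
  the next \<open>d\<close> its image under the involution in coordinate 1. Integers act diagonally,
  so the two halves do not interact.\<close>

lemma residue_basis_pair_ideal:
  assumes "residue_basis p (mod_ideal m F G) d e"
  shows "residue_basis p (pair_ideal m F G) (2 * d)
    (\<lambda>j i. if j < d then (if i = 0 then e j else 0) else (if i = 1 then bar (e (j - d)) else 0))"
    (is "residue_basis _ _ _ ?e")
proof -
  have bbar: "residue_basis p (mod_ideal m (bar F) (bar G)) d (bar \<circ> e)"
    by (rule residue_basis_bar [OF assms])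
  have "(\<Sum>j<d + n. h j) = (\<Sum>j<d. h j) + (\<Sum>j<n. h (d + j))" for h :: "nat \<Rightarrow> laurent" and n
    by (induction n) (simp_all add: ac_simps)
  from this [of _ d]
  have split: "(\<Sum>j<2 * d. h j) = (\<Sum>j<d. h j) + (\<Sum>j<d. h (d + j))" for h :: "nat \<Rightarrow> laurent"
    by (simp add: mult_2)
  have comb: "(\<Sum>j<2 * d. of_int (c j) * ?e j) 0 = (\<Sum>j<d. of_int (c j) * e j)"
    "(\<Sum>j<2 * d. of_int (c j) * ?e j) 1 = (\<Sum>j<d. of_int (c (d + j)) * (bar \<circ> e) j)"
    for c :: "nat \<Rightarrow> int"
    by (simp_all add: sum_fun_apply of_int_fun_apply split)
  have "\<exists>c :: nat \<Rightarrow> int. h - (\<Sum>j<2 * d. of_int (c j) * ?e j) \<in> pair_ideal m F G" for h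
  proof -
    obtain c c' :: "nat \<Rightarrow> int" where "h 0 - (\<Sum>j<d. of_int (c j) * e j) \<in> mod_ideal m F G"
        "h 1 - (\<Sum>j<d. of_int (c' j) * (bar \<circ> e) j) \<in> mod_ideal m (bar F) (bar G)"
      using residue_basis_span [OF assms] residue_basis_span [OF bbar] by blast
    then have "h - (\<Sum>j<2 * d. of_int (if j < d then c j else c' (j - d)) * ?e j) \<in> pair_ideal m F G"
      unfolding pair_ideal_def mem_Collect_eq minus_apply comb by simp
    then show ?thesis
      by (rule exI [of _ "\<lambda>j. if j < d then c j else c' (j - d)"])
  qed
  moreover have "\<forall>j<2 * d. p dvd c j" if "(\<Sum>j<2 * d. of_int (c j) * ?e j) \<in> pair_ideal m F G"
    for c :: "nat \<Rightarrow> int"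
  proof -
    have "(\<Sum>j<d. of_int (c j) * e j) \<in> mod_ideal m F G"
      "(\<Sum>j<d. of_int (c (d + j)) * (bar \<circ> e) j) \<in> mod_ideal m (bar F) (bar G)"
      using that unfolding pair_ideal_def mem_Collect_eq comb by auto
    then have *: "\<forall>j<d. p dvd c j" "\<forall>j<d. p dvd c (d + j)"
      using residue_basis_indep [OF assms, of c] residue_basis_indep [OF bbar, of "\<lambda>j. c (d + j)"] by auto
    show ?thesis
    proof (intro allI impI)
      show "p dvd c j" if "j < 2 * d" for j
        using *(1) *(2) [rule_format, of "j - d"] that by (cases "j < d") auto
    qed
  qed
  ultimately show ?thesis
    unfolding residue_basis_def by blast
qed

lemma genideal_proj:
  assumes N: "N > 0"
  shows "Idl\<^bsub>bb_ring N\<^esub> {proj N F, proj N G} = proj N ` mod_ideal (int N) F G"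
proof
  interpret cring "bb_ring N"
    by (rule cring_bb_ring [OF N])
  have "ideal (proj N ` mod_ideal (int N) F G) (bb_ring N)"
  proof (rule idealI)
    show "ring (bb_ring N)" ..
    show "subgroup (proj N ` mod_ideal (int N) F G) (add_monoid (bb_ring N))"
    proof (rule subgroup.intro)
      fix x
      assume "x \<in> proj N ` mod_ideal (int N) F G"
      then obtain a where "a \<in> mod_ideal (int N) F G" "x = proj N a"
        by blast
      then have "\<ominus>\<^bsub>bb_ring N\<^esub> x \<in> proj N ` mod_ideal (int N) F G"
        using ring_ideal_uminus [OF ring_ideal_mod_ideal] proj_uminus [OF N] by auto
      then show "inv\<^bsub>add_monoid (bb_ring N)\<^esub> x \<in> proj N ` mod_ideal (int N) F G"
        by (simp add: a_inv_def)
    qed (use ring_ideal_zero [OF ring_ideal_mod_ideal] ring_ideal_add [OF ring_ideal_mod_ideal]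
        proj_closed [OF N] in \<open>auto simp: proj_zero simp flip: proj_add\<close>)
    fix a x
    assume "a \<in> proj N ` mod_ideal (int N) F G" "x \<in> carrier (bb_ring N)"
    then show "x \<otimes>\<^bsub>bb_ring N\<^esub> a \<in> proj N ` mod_ideal (int N) F G"
      "a \<otimes>\<^bsub>bb_ring N\<^esub> x \<in> proj N ` mod_ideal (int N) F G"
      using ring_ideal_mult [OF ring_ideal_mod_ideal]
      by (auto simp: carrier_bb_ring N mult.commute simp flip: proj_mult)
  qed
  then show "Idl\<^bsub>bb_ring N\<^esub> {proj N F, proj N G} \<subseteq> proj N ` mod_ideal (int N) F G"
    by (rule genideal_minimal) (simp add: mod_ideal_generators)
  show "proj N ` mod_ideal (int N) F G \<subseteq> Idl\<^bsub>bb_ring N\<^esub> {proj N F, proj N G}"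
  proof
    let ?I = "Idl\<^bsub>bb_ring N\<^esub> {proj N F, proj N G}"
    fix x
    assume "x \<in> proj N ` mod_ideal (int N) F G"
    then obtain a b c where x: "x = proj N (F * a + G * b + of_int (int N) * c)"
      unfolding mod_ideal_def by blast
    have FG: "proj N F \<in> ?I" "proj N G \<in> ?I"
      using genideal_self [of "{proj N F, proj N G}"] by (auto simp: proj_closed N)
    interpret I: ideal ?I "bb_ring N"
      by (rule genideal_ideal) (simp add: proj_closed N)
    have "x = proj N (F * a + G * b)"
      unfolding x proj_eq_iff by simp
    also have "\<dots> = proj N F \<otimes>\<^bsub>bb_ring N\<^esub> proj N a \<oplus>\<^bsub>bb_ring N\<^esub> proj N G \<otimes>\<^bsub>bb_ring N\<^esub> proj N b"
      by (simp add: proj_add proj_mult N)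
    also have "\<dots> \<in> ?I"
      using FG by (intro I.a_closed I.I_r_closed proj_closed N)
    finally show "x \<in> ?I" .
  qed
qed

text \<open>The two rows of the syndrome map involve disjoint coordinates, so its image splits; this
  is the decomposition of the anyon module into two ideal quotients.\<close>

lemma syndrome_image:
  assumes N: "N > 0"
  shows "bb_syndrome N (proj N F) (proj N G) ` carrier (free_module (bb_ring N) 4) =
    vec N 2 ` pair_ideal (int N) F G"
  unfolding free_module_simps [OF N] image_image syndrome_vec [OF N]
proof (intro subset_antisym subsetI)
  fix v
  assume "v \<in> range (\<lambda>a :: nat \<Rightarrow> laurent. vec N 2 (\<lambda>i. if i = 0 then F * a 2 + G * a 3 else bar F * a 1 - bar G * a 0))"
  then obtain a :: "nat \<Rightarrow> laurent"
    where v: "v = vec N 2 (\<lambda>i. if i = 0 then F * a 2 + G * a 3 else bar F * a 1 - bar G * a 0)"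
    by blast
  have "F * a 2 + G * a 3 \<in> mod_ideal (int N) F G"
    by (rule mod_idealI [of _ _ "a 2" _ "a 3" _ 0]) simp
  moreover have "bar F * a 1 - bar G * a 0 \<in> mod_ideal (int N) (bar F) (bar G)"
    by (rule mod_idealI [of _ _ "a 1" _ "- a 0" _ 0]) simp
  ultimately have "(\<lambda>i. if i = 0 then F * a 2 + G * a 3 else bar F * a 1 - bar G * a 0) \<in> pair_ideal (int N) F G"
    by (simp add: pair_ideal_def)
  then show "v \<in> vec N 2 ` pair_ideal (int N) F G"
    unfolding v by blast
next
  fix v
  assume "v \<in> vec N 2 ` pair_ideal (int N) F G"
  then obtain a where v: "v = vec N 2 a" and a: "a 0 \<in> mod_ideal (int N) F G"
      "a 1 \<in> mod_ideal (int N) (bar F) (bar G)"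
    by (auto simp: pair_ideal_def)
  obtain b c w b' c' w' where bc: "a 0 = F * b + G * c + of_int (int N) * w"
      "a 1 = bar F * b' + bar G * c' + of_int (int N) * w'"
    using a by (auto simp: mod_ideal_def)
  \<comment> \<open>The sign of \<open>c'\<close> compensates the minus sign of \<open>bar G\<close>
    in the second row; the multiples of \<open>N\<close> vanish under \<open>vec\<close>.\<close>
  define u :: "nat \<Rightarrow> laurent" where "u i = (if i = 0 then - c' else if i = 1 then b' else if i = 2 then b else c)" for i
  have "v = vec N 2 (\<lambda>i. if i = 0 then F * u 2 + G * u 3 else bar F * u 1 - bar G * u 0)"
    unfolding v vec_eq_iff by (auto simp: less_Suc_eq numeral_2_eq_2 bc [unfolded One_nat_def] u_def numeral_3_eq_3)
  then show "v \<in> range (\<lambda>a :: nat \<Rightarrow> laurent. vec N 2 (\<lambda>i. if i = 0 then F * a 2 + G * a 3 else bar F * a 1 - bar G * a 0))"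
    by blast
qed

lemma ideal_quotient_space_dim:
  assumes p: "prime p" and basis: "residue_basis (int p) (mod_ideal (int p) F G) d e"
  shows "vectorspace.fin_dim (Zmod p) (ideal_quotient_space p (proj p F) (proj p G)) \<and>
    vectorspace.dim (Zmod p) (ideal_quotient_space p (proj p F) (proj p G)) = d"
proof -
  let ?K = "mod_ideal (int p) F G" and ?M = "bb_ring p"
  have p0: "p > 0"
    using p by (rule prime_gt_0_nat)
  have V: "ideal_quotient_space p (proj p F) (proj p G) = quot_module ?M (proj p ` ?K)"
    by (simp only: ideal_quotient_space_def genideal_proj [OF p0])
  have ker: "\<forall>a b. proj p a = proj p b \<longrightarrow> a - b \<in> ?K"
    unfolding proj_eq_iff
    using ring_ideal_dvd [OF ring_ideal_mod_ideal mod_ideal_generators(3)] by blast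
  define \<sigma> where "\<sigma> a = (proj p ` ?K) +>\<^bsub>?M\<^esub> proj p a" for a
  note quot = quot_module_of_surj [OF carrier_bb_ring [OF p0] proj_add ring_ideal_mod_ideal ker,
      folded \<sigma>_def V]
  let ?V = "ideal_quotient_space p (proj p F) (proj p G)"
  have smult: "c \<odot>\<^bsub>?V\<^esub> \<sigma> a = \<sigma> (of_int c * a)" for c a
    by (rule quot(5)) (rule proj_smult)
  show ?thesis
    by (rule vectorspace_dim_residue_basis [where \<sigma> = \<sigma> and K = ?K])
      (rule p quot(1-4) smult ring_ideal_mod_ideal mod_ideal_generators(3) basis)+
qed

definition anyon_class :: "nat \<Rightarrow> laurent \<Rightarrow> laurent \<Rightarrow> (nat \<Rightarrow> laurent) \<Rightarrow> (nat \<Rightarrow> int \<times> int \<Rightarrow> int) set" where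
  "anyon_class N F G a =
    (vec N 2 ` pair_ideal (int N) F G) +>\<^bsub>free_module (bb_ring N) 2\<^esub> vec N 2 a"

lemma anyon_module_presentation:
  fixes F G :: laurent
  assumes N: "N > 0"
  defines "M \<equiv> anyon_module N (proj N F) (proj N G)" and "\<sigma> \<equiv> anyon_class N F G"
  shows "carrier M = range \<sigma>"
    and "\<sigma> (a + b) = \<sigma> a \<oplus>\<^bsub>M\<^esub> \<sigma> b"
    and "\<zero>\<^bsub>M\<^esub> = \<sigma> 0"
    and "\<sigma> a = \<sigma> b \<longleftrightarrow> a - b \<in> pair_ideal (int N) F G"
    and "proj N t \<odot>\<^bsub>M\<^esub> \<sigma> a = \<sigma> ((\<lambda>_. t) * a)"
proof -
  have M: "M = quot_module (free_module (bb_ring N) 2) (vec N 2 ` pair_ideal (int N) F G)"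
    by (simp only: M_def anyon_module_def syndrome_image [OF N])
  have \<sigma>: "\<sigma> = (\<lambda>a. (vec N 2 ` pair_ideal (int N) F G) +>\<^bsub>free_module (bb_ring N) 2\<^esub> vec N 2 a)"
    by (simp add: \<sigma>_def anyon_class_def fun_eq_iff)
  have ker: "\<forall>a b. vec N 2 a = vec N 2 b \<longrightarrow> a - b \<in> pair_ideal (int N) F G"
  proof (intro allI impI)
    fix a b
    assume "vec N 2 a = vec N 2 b"
    then have "of_int (int N) dvd a 0 - b 0" "of_int (int N) dvd a 1 - b 1"
      unfolding vec_eq_iff by auto
    then show "a - b \<in> pair_ideal (int N) F G"
      unfolding pair_ideal_def mem_Collect_eq minus_apply
      using ring_ideal_dvd [OF ring_ideal_mod_ideal mod_ideal_generators(3)] by blast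
  qed
  note quot = quot_module_of_surj [OF free_module_simps(1,2) [OF N] ring_ideal_pair_ideal ker]
  show "carrier M = range \<sigma>" "\<sigma> (a + b) = \<sigma> a \<oplus>\<^bsub>M\<^esub> \<sigma> b" "\<zero>\<^bsub>M\<^esub> = \<sigma> 0"
    "\<sigma> a = \<sigma> b \<longleftrightarrow> a - b \<in> pair_ideal (int N) F G"
    unfolding M \<sigma> by (rule quot(1), rule quot(2), rule quot(3), rule quot(4))
  show "proj N t \<odot>\<^bsub>M\<^esub> \<sigma> a = \<sigma> ((\<lambda>_. t) * a)"
    unfolding M \<sigma> by (rule quot(5)) (rule free_module_simps(4) [OF N])
qed

lemma anyon_space_dim:
  assumes p: "prime p" and basis: "residue_basis (int p) (mod_ideal (int p) F G) d e"
  shows "vectorspace.fin_dim (Zmod p) (anyon_space p (proj p F) (proj p G)) \<and>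
    vectorspace.dim (Zmod p) (anyon_space p (proj p F) (proj p G)) = 2 * d"
proof -
  have p0: "p > 0"
    using p by (rule prime_gt_0_nat)
  let ?V = "anyon_space p (proj p F) (proj p G)" and ?\<sigma> = "anyon_class p F G"
  note pres = anyon_module_presentation [OF p0, of F G]
  have smult: "c \<odot>\<^bsub>?V\<^esub> ?\<sigma> a = ?\<sigma> (of_int c * a)" if "c \<in> carrier (Zmod p)" for c a
  proof -
    have "laurent_const (Zmod p) c = proj p (of_int c)"
    proof
      fix e
      have "c mod int p = c"
        using that by (simp add: Zmod_simps)
      then show "laurent_const (Zmod p) c e = proj p (of_int c) e"
        using coef_of_int_mult [of c 1 e]
        by (auto simp: laurent_const_def proj_def Zmod_simps lookup_one when_def zero_prod_def)
    qed
    then have "c \<odot>\<^bsub>?V\<^esub> ?\<sigma> a = proj p (of_int c) \<odot>\<^bsub>anyon_module p (proj p F) (proj p G)\<^esub> ?\<sigma> a"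
      by (simp add: anyon_space_def restrict_scalars_def)
    also have "\<dots> = ?\<sigma> ((\<lambda>_. of_int c) * a)"
      by (rule pres(5))
    also have "(\<lambda>_. of_int c) = (of_int c :: nat \<Rightarrow> laurent)"
      by (simp add: fun_eq_iff of_int_fun_apply)
    finally show ?thesis .
  qed
  have V: "carrier ?V = range ?\<sigma>" "\<And>a b. ?\<sigma> (a + b) = ?\<sigma> a \<oplus>\<^bsub>?V\<^esub> ?\<sigma> b" "\<zero>\<^bsub>?V\<^esub> = ?\<sigma> 0"
    using pres(1-3) by (simp_all add: anyon_space_def restrict_scalars_def)
  show ?thesis
    by (rule vectorspace_dim_residue_basis [where \<sigma> = ?\<sigma> and K = "pair_ideal (int p) F G"])
      (assumption | rule p V pres(4) smult ring_ideal_pair_ideal of_int_in_pair_ideal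
        residue_basis_pair_ideal [OF basis])+
qed

text \<open>The second coordinate is carried by the involution to the ideal of \<open>F\<close> and
  \<open>G\<close>, so exactness is used for this one pair only.\<close>

lemma pair_ideal_flat:
  assumes p: "prime p" and k: "k \<ge> 1" and ex: "koszul_exact (p ^ k) F G"
    and h: "of_int (p ^ (k - 1)) * h \<in> pair_ideal (p ^ k) F G"
  shows "h \<in> pair_ideal p F G"
proof -
  have "of_int (p ^ (k - 1)) * h 0 \<in> mod_ideal (p ^ k) F G"
    "of_int (p ^ (k - 1)) * h 1 \<in> mod_ideal (p ^ k) (bar F) (bar G)"
    using h unfolding pair_ideal_def mem_Collect_eq times_fun_apply of_int_fun_apply by auto
  moreover from this(2) have "bar (of_int (p ^ (k - 1)) * bar (h 1)) \<in> mod_ideal (p ^ k) (bar F) (bar G)"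
    unfolding bar_mult bar_of_int bar_bar .
  ultimately have "h 0 \<in> mod_ideal p F G" "bar (h 1) \<in> mod_ideal p F G"
    using mod_ideal_flat [OF p k ex] unfolding bar_in_mod_ideal_iff by blast+
  then show ?thesis
    using bar_in_mod_ideal_iff [of "bar (h 1)" p F G] by (simp add: pair_ideal_def)
qed

theorem theorem2:
  fixes N n :: nat and p k Q :: "nat \<Rightarrow> nat" and f g :: "int \<times> int \<Rightarrow> int"
  assumes "N > 0"
    and "N = (\<Prod>i=1..n. p i ^ k i)"
    and "inj_on p {1..n}"
    and "\<forall>i\<in>{1..n}. prime (p i) \<and> k i \<ge> 1"
    and "f \<in> carrier (bb_ring N)" and "g \<in> carrier (bb_ring N)"
    and "bb_topological N f g"
    and Q: "\<forall>i\<in>{1..n}. Q i = vectorspace.dim (Zmod (p i))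
          (ideal_quotient_space (p i) (laurent_reduce (p i) f) (laurent_reduce (p i) g))"
  shows "add_monoid (anyon_module N f g) \<cong>
      sum_group {1..n} (\<lambda>i. sum_group {..<2 * Q i} (\<lambda>_. integer_mod_group (p i ^ k i)))
    \<and> (\<forall>i\<in>{1..n}.
        vectorspace.fin_dim (Zmod (p i))
          (ideal_quotient_space (p i) (laurent_reduce (p i) f) (laurent_reduce (p i) g))
      \<and> vectorspace.fin_dim (Zmod (p i))
          (anyon_space (p i) (laurent_reduce (p i) f) (laurent_reduce (p i) g))
      \<and> real (Q i) = 1 / 2 * real (vectorspace.dim (Zmod (p i))
          (anyon_space (p i) (laurent_reduce (p i) f) (laurent_reduce (p i) g))))"
proof -
  define F G where "F = Abs_poly_mapping f" and "G = Abs_poly_mapping g"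
  have f: "f = proj N F" and g: "g = proj N G"
    unfolding F_def G_def by (rule lift_proj(1) [OF assms(5)], rule lift_proj(1) [OF assms(6)])
  have red: "laurent_reduce m f = proj m F" "laurent_reduce m g = proj m G" for m
    unfolding F_def G_def using lift_proj(2) [OF assms(5)] lift_proj(2) [OF assms(6)]
    by (simp_all add: laurent_reduce_def proj_def)
  have ex: "koszul_exact (int N) F G"
    using koszul_exact_of_topological assms(1,7) unfolding f g by blast
  have p: "prime (int (p i))" "prime (p i)" "k i \<ge> 1" if "i \<in> {1..n}" for i
    using assms(4) that by auto
  have cop: "coprime (p i ^ k i) (p j ^ k j)" if "i \<in> {1..n}" "j \<in> {1..n}" "i \<noteq> j" for i j
  proof -
    have "p i \<noteq> p j"
      using assms(3) that by (auto dest: inj_onD)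
    then have "coprime (p i) (p j)"
      using p(2) that by (intro primes_coprime)
    then show ?thesis
      by simp
  qed
  have exk: "koszul_exact (int (p i) ^ k i) F G" if i: "i \<in> {1..n}" for i
  proof (rule koszul_exact_coprime_factor)
    let ?m = "int (\<Prod>j\<in>{1..n} - {i}. p j ^ k j)"
    have "int N = int (p i) ^ k i * ?m"
      unfolding assms(2) using i by (subst prod.remove [of _ i]) auto
    then show "koszul_exact (int (p i) ^ k i * ?m) F G"
      using ex by simp
    have "coprime (p i ^ k i) (\<Prod>j\<in>{1..n} - {i}. p j ^ k j)"
      using i cop by (intro prod_coprime_right) auto
    then show "coprime (int (p i) ^ k i) ?m"
      unfolding of_nat_power [symmetric] coprime_int_iff .
  qed
  have basis: "\<exists>e. residue_basis (int (p i)) (mod_ideal (int (p i)) F G) (Q i) e" if i: "i \<in> {1..n}" for i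
  proof -
    have "koszul_exact (int (p i)) F G"
      using koszul_exact_prime_power_le [OF p(1,3) [OF i] exk [OF i], of 1] p(3) [OF i] by simp
    then obtain B where B: "\<forall>T. finite T \<longrightarrow>
        (\<forall>t\<in>T. \<forall>u\<in>T. t - u \<in> mod_ideal (int (p i)) F G \<longrightarrow> t = u) \<longrightarrow> card T \<le> B"
      using incongruent_bound [OF p(1) [OF i]] by metis
    have "\<exists>d e. residue_basis (int (p i)) (mod_ideal (int (p i)) F G) d e"
      by (rule residue_basis_exists [OF p(1) [OF i] ring_ideal_mod_ideal mod_ideal_generators(3)])
        (rule B [THEN spec, THEN mp, THEN mp])
    then obtain d e where d: "residue_basis (int (p i)) (mod_ideal (int (p i)) F G) d e"
      by blast
    \<comment> \<open>The basis was obtained with some unknown length; computing the dimension from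
      it pins the length to \<open>Q i\<close>.\<close>
    moreover have "d = Q i"
      using Q i ideal_quotient_space_dim [OF p(2) [OF i] d] by (simp add: red)
    ultimately show ?thesis
      by blast
  qed
  have "\<exists>e. \<forall>i\<in>{1..n}. residue_basis (int (p i)) (mod_ideal (int (p i)) F G) (Q i) (e i)"
    by (rule bchoice) (rule ballI, rule basis)
  then obtain e where e: "\<And>i. i \<in> {1..n} \<Longrightarrow>
      residue_basis (int (p i)) (mod_ideal (int (p i)) F G) (Q i) (e i)"
    by blast
  have dvdN: "p i ^ k i dvd N" "p i dvd N" if i: "i \<in> {1..n}" for i
  proof -
    show "p i ^ k i dvd N"
      unfolding assms(2) using i by (intro dvd_prodI) auto
    moreover have "p i dvd p i ^ k i"
      using p(3) [OF i] by (intro dvd_power) auto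
    ultimately show "p i dvd N"
      by (rule dvd_trans [rotated])
  qed
  let ?K = "pair_ideal (int N) F G"
  let ?e = "\<lambda>i j l. if j < Q i then (if l = 0 then e i j else 0)
    else (if l = (1 :: nat) then bar (e i (j - Q i)) else 0)"
  have "add_monoid (anyon_module N f g) \<cong>
      sum_group {1..n} (\<lambda>i. sum_group {..<2 * Q i} (\<lambda>_. integer_mod_group (p i ^ k i)))"
    unfolding f g
  proof (rule iso_sum_integer_mod_groups [where K = ?K and e = ?e and \<rho> = "anyon_class N F G"])
    show "of_nat (\<Prod>i = 1..n. p i ^ k i) \<in> ?K"
      using of_int_in_pair_ideal [of "int N" F G] assms(2) by simp
    show "residue_basis (int (p i ^ k i)) (ideal_plus ?K (int (p i ^ k i))) (2 * Q i) (?e i)"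
      if i: "i \<in> {1..n}" for i
      unfolding of_nat_power
    proof (rule residue_basis_prime_power)
      \<comment> \<open>Adding a divisor of \<open>N\<close> to \<open>?K\<close> gives the pair
        ideal for that divisor, so the lifting from \<open>p i\<close> to its power can be carried
        out inside the one ideal \<open>?K\<close> that presents the anyon module.\<close>
      have 1: "ideal_plus ?K (int (p i)) = pair_ideal (int (p i)) F G"
        by (rule ideal_plus_pair_ideal) (use dvdN i in simp)
      have 2: "ideal_plus ?K (int (p i) ^ k i) = pair_ideal (int (p i) ^ k i) F G"
        by (rule ideal_plus_pair_ideal) (use dvdN(1) [OF i] in \<open>simp flip: of_nat_power\<close>)
      show "residue_basis (int (p i)) (ideal_plus ?K (int (p i))) (2 * Q i) (?e i)"
        unfolding 1 by (rule residue_basis_pair_ideal [OF e [OF i]])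
      show "h \<in> ideal_plus ?K (int (p i))"
        if "of_int (int (p i) ^ (k i - 1)) * h \<in> ideal_plus ?K (int (p i) ^ k i)" for h
        using that unfolding 1 2 by (rule pair_ideal_flat [OF p(1,3) [OF i] exk [OF i]])
    qed (use p(3) [OF i] ring_ideal_pair_ideal in auto)
  qed (use p(2) cop ring_ideal_pair_ideal anyon_module_presentation [OF assms(1)] in
      \<open>auto simp: prime_gt_0_nat\<close>)
  moreover have "vectorspace.fin_dim (Zmod (p i))
          (ideal_quotient_space (p i) (laurent_reduce (p i) f) (laurent_reduce (p i) g))
      \<and> vectorspace.fin_dim (Zmod (p i))
          (anyon_space (p i) (laurent_reduce (p i) f) (laurent_reduce (p i) g))
      \<and> real (Q i) = 1 / 2 * real (vectorspace.dim (Zmod (p i))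
          (anyon_space (p i) (laurent_reduce (p i) f) (laurent_reduce (p i) g)))"
    if i: "i \<in> {1..n}" for i
    unfolding red
    using ideal_quotient_space_dim [OF p(2) e, OF i i] anyon_space_dim [OF p(2) e, OF i i] by simp
  ultimately show ?thesis
    by blast
qed

end
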